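(* Let $\kappa\ge1$ and let $(R_{\ell,\ell'})_{\ell,\ell'\ge1}$ be a random array of $\kappa\times\kappa$ matrices arising as a limit in distribution, along a subsequence, of the overlap arrays of the perturbed constrained Potts spin glass described in the context. Suppose that this array satisfies the following identities: for all $n\ge2$, all bounded measurable functions $f=f(R^n)$ of $R^n=(R_{\ell,\ell'})_{\ell,\ell'\le n}$, all integers $p,m\ge1$, all $\lambda^1,\dots,\lambda^m\in[-1,1]^\kappa$ and all bounded measurable $\varphi:\mathbb R^m\to\mathbb R$, setting $Q_{\ell,\ell'}=\varphi\bigl((R_{\ell,\ell'}^{\circ p}\lambda^1,\lambda^1),\dots,(R_{\ell,\ell'}^{\circ p}\lambda^m,\lambda^m)\bigr)$, $$\mathbb E f(R^n)Q_{1,n+1}=\frac1n\,\mathbb E f(R^n)\,\mathbb E Q_{1,2}+\frac1n\sum_{\ell=2}^n\mathbb E f(R^n)Q_{1,\ell}.$$ Then there exists a function $\Phi:\mathbb R^+\to\Gamma_\kappa$ such that $$R_{\ell,\ell'}=\Phi\bigl(\mathrm{tr}(R_{\ell,\ell'})\bigr)\quad\text{almost surely.}$$ Moreover, one can take $\Phi$ to be non-decreasing, in the sense that $\Phi(x')-\Phi(x)\in\Gamma_\kappa$ for all $x\le x'$, and Lipschitz continuous, $\|\Phi(x')-\Phi(x)\|_1\le L_\kappa|x'-x|$, for some constant $L_\kappa$ that depends only on $\kappa$.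
   Context: Notation. $\Gamma_\kappa$ is the set of $\kappa\times\kappa$ real symmetric positive-semidefinite matrices; $\|\gamma\|_1=\sum_{k,k'}|\gamma_{k,k'}|$; $A^{\circ p}$ is the entrywise $p$-th power of a matrix $A$; $(\cdot,\cdot)$ is the Euclidean scalar product; $\mathbb R^+=[0,\infty)$. Constrained configurations. $\mathcal D=\{d\in\mathbb R^\kappa: d_k\ge0,\sum_kd_k=1\}$; $\Sigma_N(d)=\{\sigma\in\{1,\dots,\kappa\}^N:\sum_{i\le N}\mathrm I(\sigma_i=k)=Nd_k\ \forall k\le\kappa\}$; $\mathcal D_N=\{d\in\mathcal D:\Sigma_N(d)\ne\emptyset\}$. Fix $d^N\in\mathcal D_N$ for each $N$. Hamiltonian. $H_N(\sigma)=\frac1{\sqrt N}\sum_{i,j\le N}g_{ij}\mathrm I(\sigma_i=\sigma_j)$ with i.i.d. standard Gaussian $g_{ij}$. Perturbation. For $e=(i_1,\dots,i_p)\in\{1,\dots,N\}^p$ and $\lambda\in\mathbb R^\kappa$ let $S_\lambda(\sigma_e)=\sum_{k\le\kappa}\lambda_k\mathrm I(\sigma_{i_1}=k)\cdots\mathrm I(\sigma_{i_p}=k)$, and for $I=(e_1,\dots,e_n)\in(\{1,\dots,N\}^p)^n$ let $S_\lambda(\sigma_I)=S_\lambda(\sigma_{e_1})\cdots S_\lambda(\sigma_{e_n})$. Let $\Theta$ be the (countable) set of all $\theta=(p,m,n_1,\dots,n_m,\lambda^1,\dots,\lambda^m)$ with integers $p,m,n_j\ge1$ and $\lambda^j\in([-1,1]\cap\mathbb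 Q)^\kappa$. For $\theta\in\Theta$ let $$h_\theta(\sigma)=N^{-p(n_1+\dots+n_m)/2}\sum_{I_1,\dots,I_m}g_{I_1,\dots,I_m}S_{\lambda^1}(\sigma_{I_1})\cdots S_{\lambda^m}(\sigma_{I_m}),\quad I_j\in(\{1,\dots,N\}^p)^{n_j},$$ with standard Gaussian coefficients, all independent (also over $\theta$ and of $(g_{ij})$). Fix an injection $j_0:([-1,1]\cap\mathbb Q)^\kappa\to\mathbb N$ and let $j(\theta)=p+\sum_jn_j+\sum_jj_0(\lambda^j)+4m$. For $u=(u_\theta)\in[1,2]^\Theta$ let $h_N(\sigma)=\sum_{\theta\in\Theta}2^{-j(\theta)}u_\theta h_\theta(\sigma)$, and $H_N^{\rm pert}=H_N+s_Nh_N$ with $s_N=N^{a}$ for a fixed $a\in(1/4,1/2)$. Gibbs measure and overlaps. $G_N(\sigma)\propto\exp H_N^{\rm pert}(\sigma)$ on $\Sigma_N(d^N)$, with $u=u^N\in[1,2]^\Theta$ non-random. For i.i.d. replicas $(\sigma^\ell)_{\ell\ge1}$ from $G_N$, $R_{\ell,\ell'}=(R_{\ell,\ell'}^{k,k'})_{k,k'\le\kappa}$ with $R_{\ell,\ell'}^{k,k'}=\frac1N\sum_{i\le N}\mathrm I(\sigma_i^\ell=k)\mathrm I(\sigma_i^{\ell'}=k')$. The array in the claim is a limit in distribution (in the sense of finite-dimensional distributions) of $(R_{\ell,\ell'})_{\ell,\ell'\ge1}$ under $\mathbb E G_N^{\otimes\infty}$ along some subsequence of $N$; the same notation is used for the limiting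 array. *)

theory Defs
  imports "HOL-Probability.Probability"
begin

section \<open>Matrices\<close>

text \<open>
  The number of colours \<open>\<kappa>\<close> is the cardinality of the finite index type \<open>'k\<close>; real \<open>\<kappa> \<times> \<kappa>\<close>
  matrices are elements of \<open>real ^ 'k ^ 'k\<close>.
\<close>

definition psd :: "(real ^ 'k ^ 'k) set" where
  "psd = {A. transpose A = A \<and> (\<forall>x. 0 \<le> x \<bullet> (A *v x))}"

definition norm1 :: "real ^ 'k ^ 'k \<Rightarrow> real" where
  "norm1 A = (\<Sum>k\<in>UNIV. \<Sum>k'\<in>UNIV. \<bar>A $ k $ k'\<bar>)"

definition entrywise_power :: "real ^ 'k ^ 'k \<Rightarrow> nat \<Rightarrow> real ^ 'k ^ 'k" where
  "entrywise_power A p = (\<chi> k k'. (A $ k $ k') ^ p)"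


section \<open>Constrained configurations\<close>

definition proportions :: "(real ^ 'k) set" where
  "proportions = {d. (\<forall>k. 0 \<le> d $ k) \<and> (\<Sum>k\<in>UNIV. d $ k) = 1}"

definition configs :: "nat \<Rightarrow> real ^ 'k \<Rightarrow> (nat \<Rightarrow> 'k) set" where
  "configs N d = {\<sigma> \<in> {1..N} \<rightarrow>\<^sub>E UNIV.
     \<forall>k. (\<Sum>i\<in>{1..N}. of_bool (\<sigma> i = k)) = real N * d $ k}"

definition attainable_proportions :: "nat \<Rightarrow> (real ^ 'k) set" where
  "attainable_proportions N = {d \<in> proportions. configs N d \<noteq> {}}"


section \<open>Disorder\<close>

text \<open>
  The index \<open>\<theta> = (p, m, n\<^sub>1, \<dots>, n\<^sub>m, \<lambda>\<^sup>1, \<dots>, \<lambda>\<^sup>m)\<close> of a perturbation term is encoded as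
  \<open>(p, [(n\<^sub>1, \<lambda>\<^sup>1), \<dots>, (n\<^sub>m, \<lambda>\<^sup>m)])\<close>, the number \<open>m\<close> being the length of the list.
\<close>

type_synonym 'k pert_index = "nat \<times> (nat \<times> (real ^ 'k)) list"

definition rational_cube :: "(real ^ 'k) set" where
  "rational_cube = {l. \<forall>k. l $ k \<in> {-1..1} \<inter> \<rat>}"

definition pert_indices :: "'k::finite pert_index set" where
  "pert_indices = {(p, xs). 1 \<le> p \<and> xs \<noteq> [] \<and> (\<forall>(n, l)\<in>set xs. 1 \<le> n \<and> l \<in> rational_cube)}"

text \<open>
  The Gaussian coefficients are indexed by the following type: \<open>Pair_coupling i j\<close> is the index
  of \<open>g\<^sub>i\<^sub>j\<close> in the Hamiltonian, \<open>Pert_coupling \<theta> [I\<^sub>1, \<dots>, I\<^sub>m]\<close> that of the coefficient of the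
  term \<open>(I\<^sub>1, \<dots>, I\<^sub>m)\<close> in \<open>h\<^sub>\<theta>\<close>. Each \<open>I\<^sub>j\<close> is a list of \<open>n\<^sub>j\<close> lists of \<open>p\<close> sites. Only the joint
  law of the coefficients matters, so they are taken to be the coordinates of a product space;
  coordinates that do not occur in the model are harmless.
\<close>

datatype ('k::finite) coupling_index =
    Pair_coupling nat nat
  | Pert_coupling "'k pert_index" "nat list list list"

definition disorder :: "('k::finite coupling_index \<Rightarrow> real) measure" where
  "disorder = (\<Pi>\<^sub>M c\<in>UNIV. density lborel std_normal_density)"


section \<open>The perturbed Hamiltonian\<close>

definition hamiltonian ::
    "('k::finite coupling_index \<Rightarrow> real) \<Rightarrow> nat \<Rightarrow> (nat \<Rightarrow> 'k) \<Rightarrow> real" where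
  "hamiltonian g N \<sigma> =
     1 / sqrt (real N) * (\<Sum>i\<in>{1..N}. \<Sum>j\<in>{1..N}. g (Pair_coupling i j) * of_bool (\<sigma> i = \<sigma> j))"

definition S_sites :: "real ^ 'k \<Rightarrow> (nat \<Rightarrow> 'k) \<Rightarrow> nat list \<Rightarrow> real" where
  "S_sites l \<sigma> e = (\<Sum>k\<in>UNIV. l $ k * (\<Prod>i\<leftarrow>e. of_bool (\<sigma> i = k)))"

definition S_multi :: "real ^ 'k \<Rightarrow> (nat \<Rightarrow> 'k) \<Rightarrow> nat list list \<Rightarrow> real" where
  "S_multi l \<sigma> I = (\<Prod>e\<leftarrow>I. S_sites l \<sigma> e)"

definition site_tuples :: "nat \<Rightarrow> 'k::finite pert_index \<Rightarrow> nat list list list set" where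
  "site_tuples N = (\<lambda>(p, xs).
     {Is. list_all2
            (\<lambda>I (n, l). length I = n \<and> (\<forall>e\<in>set I. length e = p \<and> set e \<subseteq> {1..N})) Is xs})"

definition pert_term ::
    "('k::finite coupling_index \<Rightarrow> real) \<Rightarrow> nat \<Rightarrow> 'k::finite pert_index \<Rightarrow> (nat \<Rightarrow> 'k) \<Rightarrow> real" where
  "pert_term g N = (\<lambda>(p, xs) \<sigma>.
     real N powr (- (real p * real (\<Sum>(n, l)\<leftarrow>xs. n) / 2)) *
     (\<Sum>Is\<in>site_tuples N (p, xs).
        g (Pert_coupling (p, xs) Is) * (\<Prod>(I, n, l)\<leftarrow>zip Is xs. S_multi l \<sigma> I)))"

definition pert_exponent :: "(real ^ 'k \<Rightarrow> nat) \<Rightarrow> 'k::finite pert_index \<Rightarrow> nat" where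
  "pert_exponent j0 = (\<lambda>(p, xs).
     p + (\<Sum>(n, l)\<leftarrow>xs. n) + (\<Sum>(n, l)\<leftarrow>xs. j0 l) + 4 * length xs)"

definition perturbation ::
    "(real ^ 'k \<Rightarrow> nat) \<Rightarrow> ('k::finite pert_index \<Rightarrow> real) \<Rightarrow> ('k::finite coupling_index \<Rightarrow> real)
      \<Rightarrow> nat \<Rightarrow> (nat \<Rightarrow> 'k) \<Rightarrow> real" where
  "perturbation j0 u g N \<sigma> =
     (\<Sum>\<^sub>\<infinity>\<theta>\<in>pert_indices. (1 / 2) ^ pert_exponent j0 \<theta> * u \<theta> * pert_term g N \<theta> \<sigma>)"

definition perturbed_hamiltonian ::
    "(real ^ 'k \<Rightarrow> nat) \<Rightarrow> real \<Rightarrow> ('k::finite pert_index \<Rightarrow> real) \<Rightarrow> ('k::finite coupling_index \<Rightarrow> real)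
      \<Rightarrow> nat \<Rightarrow> (nat \<Rightarrow> 'k) \<Rightarrow> real" where
  "perturbed_hamiltonian j0 a u g N \<sigma> =
     hamiltonian g N \<sigma> + real N powr a * perturbation j0 u g N \<sigma>"


section \<open>Gibbs measure and overlaps\<close>

definition gibbs_weight ::
    "(real ^ 'k \<Rightarrow> nat) \<Rightarrow> real \<Rightarrow> ('k::finite pert_index \<Rightarrow> real) \<Rightarrow> ('k::finite coupling_index \<Rightarrow> real)
      \<Rightarrow> nat \<Rightarrow> real ^ 'k \<Rightarrow> (nat \<Rightarrow> 'k) \<Rightarrow> real" where
  "gibbs_weight j0 a u g N d \<sigma> =
     exp (perturbed_hamiltonian j0 a u g N \<sigma>) /
     (\<Sum>\<tau>\<in>configs N d. exp (perturbed_hamiltonian j0 a u g N \<tau>))"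

definition overlap :: "nat \<Rightarrow> (nat \<Rightarrow> 'k) \<Rightarrow> (nat \<Rightarrow> 'k) \<Rightarrow> real ^ 'k ^ 'k" where
  "overlap N \<sigma> \<tau> =
     (\<chi> k k'. 1 / real N * (\<Sum>i\<in>{1..N}. of_bool (\<sigma> i = k) * of_bool (\<tau> i = k')))"

text \<open>
  Arrays \<open>(R\<^sub>\<ell>\<^sub>,\<^sub>\<ell>\<^sub>')\<close> are functions of the pair \<open>(\<ell>, \<ell>')\<close>, and \<open>R\<^sup>n\<close> is the
  restriction of \<open>R\<close> to \<open>block n\<close>. The next definition is the expectation of \<open>F(R\<^sup>n)\<close> under
  \<open>\<bbbE> G\<^sub>N\<^sup>\<otimes>\<^sup>\<infinity>\<close>, the sum running over \<open>n\<close>-tuples of replicas.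
\<close>

definition block :: "nat \<Rightarrow> (nat \<times> nat) set" where
  "block n = {1..n} \<times> {1..n}"

definition replica_expectation ::
    "(real ^ 'k \<Rightarrow> nat) \<Rightarrow> real \<Rightarrow> ('k::finite pert_index \<Rightarrow> real) \<Rightarrow> nat \<Rightarrow> real ^ 'k
      \<Rightarrow> nat \<Rightarrow> ((nat \<times> nat \<Rightarrow> real ^ 'k ^ 'k) \<Rightarrow> real) \<Rightarrow> real" where
  "replica_expectation j0 a u N d n F =
     (\<integral>g. (\<Sum>s\<in>{1..n} \<rightarrow>\<^sub>E configs N d.
              (\<Prod>l\<in>{1..n}. gibbs_weight j0 a u g N d (s l)) *
              F (\<lambda>(l, l')\<in>block n. overlap N (s l) (s l'))) \<partial>disorder)"


section \<open>Limiting overlap arrays\<close>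

text \<open>
  A random array is represented by its law \<open>\<mu>\<close> on the space of all arrays indexed by
  \<open>\<ell>, \<ell>' \<ge> 1\<close>.
\<close>

definition array_law :: "(nat \<times> nat \<Rightarrow> real ^ 'k ^ 'k) measure \<Rightarrow> bool" where
  "array_law \<mu> \<longleftrightarrow> prob_space \<mu> \<and> sets \<mu> = sets (\<Pi>\<^sub>M x\<in>{1..} \<times> {1..}. borel)"

definition limiting_overlap_law ::
    "(real ^ 'k \<Rightarrow> nat) \<Rightarrow> real \<Rightarrow> (nat \<Rightarrow> 'k::finite pert_index \<Rightarrow> real) \<Rightarrow> (nat \<Rightarrow> real ^ 'k)
      \<Rightarrow> (nat \<Rightarrow> nat) \<Rightarrow> (nat \<times> nat \<Rightarrow> real ^ 'k ^ 'k) measure \<Rightarrow> bool" where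
  "limiting_overlap_law j0 a u d r \<mu> \<longleftrightarrow>
     array_law \<mu> \<and>
     (\<forall>n F. continuous_map (product_topology (\<lambda>x. euclidean) (block n)) euclideanreal F \<and>
            (\<exists>C. \<forall>R\<in>block n \<rightarrow>\<^sub>E UNIV. \<bar>F R\<bar> \<le> C) \<longrightarrow>
        (\<lambda>i. replica_expectation j0 a (u (r i)) (r i) (d (r i)) n F)
          \<longlonglongrightarrow> (\<integral>R. F (restrict R (block n)) \<partial>\<mu>))"

definition Q_fun :: "nat \<Rightarrow> nat \<Rightarrow> (nat \<Rightarrow> real ^ 'k) \<Rightarrow> ((nat \<Rightarrow> real) \<Rightarrow> real)
    \<Rightarrow> real ^ 'k ^ 'k \<Rightarrow> real" where
  "Q_fun p m \<Lambda> \<phi> A = \<phi> (\<lambda>j\<in>{1..m}. (entrywise_power A p *v \<Lambda> j) \<bullet> \<Lambda> j)"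

definition multi_species_GG :: "(nat \<times> nat \<Rightarrow> real ^ 'k ^ 'k) measure \<Rightarrow> bool" where
  "multi_species_GG \<mu> \<longleftrightarrow>
     (\<forall>n f p m \<Lambda> \<phi>.
        2 \<le> n \<and>
        f \<in> borel_measurable (\<Pi>\<^sub>M x\<in>block n. borel) \<and>
        (\<exists>C. \<forall>R\<in>block n \<rightarrow>\<^sub>E UNIV. \<bar>f R\<bar> \<le> C) \<and>
        1 \<le> p \<and> 1 \<le> m \<and>
        (\<forall>j\<in>{1..m}. \<forall>k. \<Lambda> j $ k \<in> {-1..1}) \<and>
        \<phi> \<in> borel_measurable (\<Pi>\<^sub>M j\<in>{1..m}. borel) \<and>
        (\<exists>C. \<forall>x\<in>{1..m} \<rightarrow>\<^sub>E UNIV. \<bar>\<phi> x\<bar> \<le> C) \<longrightarrow>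
        (\<integral>R. f (restrict R (block n)) * Q_fun p m \<Lambda> \<phi> (R (1, n + 1)) \<partial>\<mu>) =
          1 / real n * (\<integral>R. f (restrict R (block n)) \<partial>\<mu>) * (\<integral>R. Q_fun p m \<Lambda> \<phi> (R (1, 2)) \<partial>\<mu>) +
          1 / real n *
            (\<Sum>l\<in>{2..n}. \<integral>R. f (restrict R (block n)) * Q_fun p m \<Lambda> \<phi> (R (1, l)) \<partial>\<mu>))"

end

theory Submission
  imports Defs
begin

text \<open>
  For \<open>p = 1\<close> the identities say that, given \<open>R\<^sup>n\<close>, the symmetric part of
  \<open>R\<^sub>1\<^sub>,\<^sub>n\<^sub>+\<^sub>1\<close> is with probability \<open>1/n\<close> an independent copy of that of \<open>R\<^sub>1\<^sub>,\<^sub>2\<close>, and otherwise equal to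
  that of a uniformly chosen \<open>R\<^sub>1\<^sub>,\<^sub>\<ell>\<close>. Together with exchangeability this yields a duplication
  property: any array in the support of the law can be extended, within the support, by a twin of
  one of its replicas, which has the same overlaps with all other replicas and whose overlap with
  the original has the same symmetric part as one of the existing overlaps. Otherwise the original
  would be the only one of its kind among \<open>k + 1\<close> replicas with probability of order
  \<open>k\<^sup>-\<^sup>\<gamma>\<close>, \<open>\<gamma> < 1\<close>, while exchangeability bounds that probability by \<open>1 / (k + 1)\<close>.

  Duplicating both replicas of a pair many times and averaging the configurations in each of the two
  groups, positive definiteness of Gram matrices forces the two averages to coincide, so
  \<open>R\<^sub>1\<^sub>,\<^sub>2\<close> is symmetric and positive semidefinite. The same
  argument for triples shows that \<open>v \<bullet> R v + w \<bullet> R w\<close> is ultrametric for all \<open>v, w\<close>. If two points \<open>X, Y\<close>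
  of the support of \<open>R\<^sub>1\<^sub>,\<^sub>2\<close> were incomparable, some \<open>v\<close> and \<open>w\<close> would order them in opposite ways, and
  the third overlap of a triple with overlaps \<open>X, Y\<close> would violate ultrametricity for \<open>v, w\<close>. The
  support is thus a chain of positive semidefinite matrices, on which the trace is injective with
  Lipschitz inverse; interpolating linearly across the gaps gives \<open>\<Phi>\<close>.
\<close>

section \<open>Chains of positive semidefinite matrices\<close>

lemma inner_matrix_vector_sum:
  fixes X :: "real ^ 'k ^ 'k"
  shows "x \<bullet> (X *v y) = (\<Sum>k\<in>UNIV. \<Sum>k'\<in>UNIV. x $ k * X $ k $ k' * y $ k')"
  by (simp add: inner_vec_def matrix_vector_mult_def sum_distrib_left mult.assoc)

lemma inner_axis_matrix: "axis k 1 \<bullet> ((X :: real ^ 'k ^ 'k) *v axis k' 1) = X $ k $ k'"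
  by (simp add: inner_axis' matrix_vector_mult_def) (simp add: axis_def if_distrib cong: if_cong)

lemma inner_transpose_matrix: "x \<bullet> (transpose X *v y) = y \<bullet> ((X :: real ^ 'k ^ 'k) *v x)"
  by (metis dot_lmul_matrix inner_commute transpose_matrix_vector)

lemma psd_iff: "A \<in> psd \<longleftrightarrow> (\<forall>k k'. A $ k $ k' = A $ k' $ k) \<and> (\<forall>x. 0 \<le> x \<bullet> (A *v x))"
  by (auto simp: psd_def transpose_def vec_eq_iff)

lemma psd_0: "0 \<in> psd"
  by (simp add: psd_iff)

lemma psd_add: "A \<in> psd \<Longrightarrow> B \<in> psd \<Longrightarrow> A + B \<in> psd"
  by (simp add: psd_iff matrix_vector_mult_add_rdistrib inner_add_right)

lemma psd_scaleR: "A \<in> psd \<Longrightarrow> 0 \<le> c \<Longrightarrow> c *\<^sub>R A \<in> psd"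
  by (simp add: psd_iff flip: scaleR_matrix_vector_assoc)

lemma psd_diff_trans: "B - A \<in> psd \<Longrightarrow> C - B \<in> psd \<Longrightarrow> C - A \<in> psd"
  using psd_add[of "B - A" "C - B"] by simp

lemma closed_psd: "closed (psd :: (real ^ 'k ^ 'k) set)"
proof -
  have "psd = (\<Inter>k k'. {A :: real ^ 'k ^ 'k. A $ k $ k' = A $ k' $ k}) \<inter> (\<Inter>x. {A. 0 \<le> x \<bullet> (A *v x)})"
    by (auto simp: psd_iff)
  also have "closed \<dots>"
    unfolding inner_matrix_vector_sum
    by (intro closed_Int closed_INT ballI closed_Collect_eq closed_Collect_le continuous_intros)
  finally show ?thesis .
qed

text \<open>Evaluating the form at e_k + e_k' and e_k - e_k' lets the diagonal control every
  entry.\<close>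

lemma psd_entry_le:
  assumes "A \<in> psd" shows "2 * \<bar>A $ k $ k'\<bar> \<le> A $ k $ k + A $ k' $ k'"
proof -
  have *: "0 \<le> (axis k 1 + c *\<^sub>R axis k' 1) \<bullet> (A *v (axis k 1 + c *\<^sub>R axis k' 1))" for c
    using assms by (simp add: psd_iff)
  have "A $ k $ k' = A $ k' $ k" using assms by (simp add: psd_iff)
  then have "0 \<le> A $ k $ k + 2 * c * A $ k $ k' + c * c * A $ k' $ k'" for c
    using *[of c] by (simp add: matrix_vector_right_distrib inner_add_left inner_add_right
        matrix_vector_mult_scaleR inner_axis_matrix algebra_simps)
  from this[of 1] this[of "-1"] show ?thesis by (simp add: abs_le_iff)
qed

lemma psd_diag_nonneg: "A \<in> psd \<Longrightarrow> 0 \<le> A $ k $ k"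
  using psd_entry_le[of A k k] by simp

lemma psd_trace_nonneg: "A \<in> psd \<Longrightarrow> 0 \<le> trace A"
  by (simp add: trace_def psd_diag_nonneg sum_nonneg)

text \<open>In the sum of the entrywise bounds each diagonal entry appears \<kappa> times; this is
  the source of the Lipschitz constant.\<close>

lemma psd_norm1_le:
  fixes A :: "real ^ 'k ^ 'k"
  assumes "A \<in> psd" shows "norm1 A \<le> real CARD('k) * trace A"
proof -
  have "norm1 A \<le> (\<Sum>k\<in>(UNIV :: 'k set). \<Sum>k'\<in>(UNIV :: 'k set). (A $ k $ k + A $ k' $ k') / 2)"
    unfolding norm1_def using psd_entry_le[OF assms] by (intro sum_mono) (simp add: field_simps)
  also have "\<dots> = real CARD('k) * trace A"
    by (simp add: trace_def sum.distrib sum_divide_distrib[symmetric] sum_distrib_left[symmetric]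
        add_divide_distrib)
  finally show ?thesis .
qed

lemma psd_trace_0:
  assumes "A \<in> psd" "trace A = 0" shows "A = 0"
proof -
  have "\<And>k. A $ k $ k = 0"
    using assms psd_diag_nonneg[OF assms(1)] by (simp add: trace_def sum_nonneg_eq_0_iff)
  then show ?thesis using psd_entry_le[OF assms(1)] by (auto simp: vec_eq_iff)
qed

lemma trace_scaleR: "trace (c *\<^sub>R A) = c * trace (A :: real ^ 'k ^ 'k)"
  by (simp add: trace_def sum_distrib_left)

text \<open>A positive semidefinite matrix of trace 0 vanishes, so the trace is injective on a chain
  and \<open>V\<close> is parametrized by the compact set of its traces. The parametrization is
  extended linearly across the gaps and held constant beyond the largest trace.\<close>

lemma psd_chain_extension:
  fixes V :: "(real ^ 'k ^ 'k) set"
  assumes compact: "compact V" and zero: "0 \<in> V" and psd: "V \<subseteq> psd"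
    and chain: "\<And>A B. A \<in> V \<Longrightarrow> B \<in> V \<Longrightarrow> B - A \<in> psd \<or> A - B \<in> psd"
  obtains \<Phi> where "\<And>x. 0 \<le> x \<Longrightarrow> \<Phi> x \<in> psd" "\<And>A. A \<in> V \<Longrightarrow> \<Phi> (trace A) = A"
    "\<And>x x'. 0 \<le> x \<Longrightarrow> x \<le> x' \<Longrightarrow> \<Phi> x' - \<Phi> x \<in> psd"
    "\<And>x x'. 0 \<le> x \<Longrightarrow> x \<le> x' \<Longrightarrow> trace (\<Phi> x' - \<Phi> x) \<le> x' - x"
proof -
  define T where "T = trace ` V"
  have cont: "continuous_on V (trace :: real ^ 'k ^ 'k \<Rightarrow> real)"
    unfolding trace_def by (intro continuous_intros)
  have T: "compact T" "0 \<in> T" "\<And>t. t \<in> T \<Longrightarrow> 0 \<le> t"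
    using compact zero psd psd_trace_nonneg compact_continuous_image[OF cont]
    by (force simp: T_def trace_def)+
  have inj: "inj_on trace V"
  proof
    fix A B assume AB: "A \<in> V" "B \<in> V" "trace A = trace B"
    then show "A = B" using chain[OF AB(1,2)] psd_trace_0[of "A - B"] psd_trace_0[of "B - A"]
      by (auto simp: trace_sub)
  qed
  define \<Psi> where "\<Psi> = inv_into V trace"
  have \<Psi>: "\<Psi> (trace A) = A" if "A \<in> V" for A
    using that inj by (simp add: \<Psi>_def)
  have \<Psi>V: "\<Psi> t \<in> V" "trace (\<Psi> t) = t" if "t \<in> T" for t
    using that by (auto simp: \<Psi>_def T_def inv_into_into f_inv_into_f)
  have mono: "\<Psi> t' - \<Psi> t \<in> psd" if t: "t \<in> T" "t' \<in> T" "t \<le> t'" for t t'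
  proof (cases "t = t'")
    case False
    then have "\<not> \<Psi> t - \<Psi> t' \<in> psd"
      using psd_trace_nonneg[of "\<Psi> t - \<Psi> t'"] t by (auto simp: trace_sub \<Psi>V)
    then show ?thesis using chain[of "\<Psi> t" "\<Psi> t'"] \<Psi>V t by auto
  qed (simp add: psd_0)
  have \<Psi>psd: "\<Psi> t \<in> psd" if "t \<in> T" for t using \<Psi>V[OF that] psd by auto
  define m where "m = Sup T"
  have Tb: "bdd_above T" "bdd_below T" "closed T"
    using T(1) by (auto intro: compact_imp_closed compact_imp_bounded bounded_imp_bdd_above
        bounded_imp_bdd_below)
  have m: "m \<in> T" "\<And>t. t \<in> T \<Longrightarrow> t \<le> m"
    using closed_contains_Sup[of T] T Tb cSup_upper[of _ T] by (auto simp: m_def)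
  \<comment> \<open>\<open>a x\<close> and \<open>b x\<close> are the points of \<open>T\<close>
    nearest to \<open>x\<close> from below and from above; \<open>0 \<in> T\<close> makes the first
    exist for every \<open>x \<ge> 0\<close>.\<close>
  define a where "a x = Sup (T \<inter> {..x})" for x
  define b where "b x = Inf (T \<inter> {x..})" for x
  have a: "a x \<in> T" "a x \<le> x" "\<And>t. t \<in> T \<Longrightarrow> t \<le> x \<Longrightarrow> t \<le> a x" if "0 \<le> x" for x
  proof -
    have "bdd_above (T \<inter> {..x})" "closed (T \<inter> {..x})" "T \<inter> {..x} \<noteq> {}"
      using T that by (auto intro: compact_imp_closed)
    then show "a x \<in> T" "a x \<le> x" "\<And>t. t \<in> T \<Longrightarrow> t \<le> x \<Longrightarrow> t \<le> a x"
      using closed_contains_Sup[of "T \<inter> {..x}"] cSup_upper[of _ "T \<inter> {..x}"] by (auto simp: a_def)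
  qed
  have b: "b x \<in> T" "x \<le> b x" "\<And>t. t \<in> T \<Longrightarrow> x \<le> t \<Longrightarrow> b x \<le> t" if "x \<le> m" for x
  proof -
    have "bdd_below (T \<inter> {x..})" "closed (T \<inter> {x..})" "T \<inter> {x..} \<noteq> {}"
      using T m that by (auto intro: compact_imp_closed)
    then show "b x \<in> T" "x \<le> b x" "\<And>t. t \<in> T \<Longrightarrow> x \<le> t \<Longrightarrow> b x \<le> t"
      using closed_contains_Inf[of "T \<inter> {x..}"] cInf_lower[of _ "T \<inter> {x..}"] by (auto simp: b_def)
  qed
  \<comment> \<open>For \<open>x\<close> in \<open>T\<close> the quotient is 0 / 0 = 0 by
    convention, which leaves \<open>\<Psi> x\<close>.\<close>
  define \<gamma> where "\<gamma> x = \<Psi> (a x) + ((x - a x) / (b x - a x)) *\<^sub>R (\<Psi> (b x) - \<Psi> (a x))" for x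
  have ab: "a x \<in> T" "b x \<in> T" "a x \<le> b x" "0 \<le> (x - a x) / (b x - a x)"
    "(x - a x) / (b x - a x) \<le> 1" if "0 \<le> x" "x \<le> m" for x
    using a[OF that(1)] b[OF that(2)] by (auto simp: divide_le_eq_1)
  have \<gamma>a: "\<gamma> x - \<Psi> t \<in> psd" if "t \<in> T" "t \<le> x" "x \<le> m" for x t
  proof -
    have x: "0 \<le> x" using that T by force
    have "\<gamma> x - \<Psi> (a x) \<in> psd"
      unfolding \<gamma>_def using psd_scaleR[OF mono[OF ab(1-3)] ab(4)] x that by simp
    then show ?thesis using psd_diff_trans mono a x that by meson
  qed
  have \<gamma>b: "\<Psi> t - \<gamma> x \<in> psd" if "t \<in> T" "x \<le> t" "0 \<le> x" for x t
  proof -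
    have x: "x \<le> m" using that m by force
    have "\<Psi> (b x) - \<gamma> x = (1 - (x - a x) / (b x - a x)) *\<^sub>R (\<Psi> (b x) - \<Psi> (a x))"
      by (simp add: \<gamma>_def algebra_simps)
    also have "\<dots> \<in> psd" using psd_scaleR[OF mono[OF ab(1-3)]] ab(5) x that by simp
    finally show ?thesis using psd_diff_trans mono b x that by meson
  qed
  have \<gamma>mono: "\<gamma> x' - \<gamma> x \<in> psd" if "0 \<le> x" "x \<le> x'" "x' \<le> m" for x x'
  \<comment> \<open>A point of \<open>T\<close> between \<open>x\<close> and \<open>x'\<close> is
    compared with both; otherwise both lie in one gap and share its endpoints.\<close>
  proof (cases "\<exists>t\<in>T. x \<le> t \<and> t \<le> x'")
    case True
    then obtain t where t: "t \<in> T" "x \<le> t" "t \<le> x'" by blast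
    show ?thesis by (rule psd_diff_trans[OF \<gamma>b[OF t(1,2)] \<gamma>a[OF t(1,3)]]) (use that in auto)
  next
    case False
    then have "T \<inter> {..x} = T \<inter> {..x'}" "T \<inter> {x..} = T \<inter> {x'..}" using that by force+
    then have eq: "a x' = a x" "b x' = b x" by (auto simp: a_def b_def)
    have "\<gamma> x' - \<gamma> x = ((x' - x) / (b x - a x)) *\<^sub>R (\<Psi> (b x) - \<Psi> (a x))"
      by (simp add: \<gamma>_def eq scaleR_left_diff_distrib[symmetric] diff_divide_distrib[symmetric])
    also have "\<dots> \<in> psd"
      by (rule psd_scaleR[OF mono[OF ab(1-3)]]) (use ab[of x] that in auto)
    finally show ?thesis .
  qed
  have \<gamma>tr: "trace (\<gamma> x) = x" if "0 \<le> x" "x \<le> m" for x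
  proof -
    have "trace (\<gamma> x) = a x + ((x - a x) / (b x - a x)) * (b x - a x)"
      using \<Psi>V(2)[OF ab(1)[OF that]] \<Psi>V(2)[OF ab(2)[OF that]]
      by (simp add: \<gamma>_def trace_add trace_sub trace_scaleR)
    also have "\<dots> = x" using a(2)[OF that(1)] b(2)[OF that(2)] by (cases "b x = a x") auto
    finally show ?thesis .
  qed
  have \<gamma>T: "\<gamma> t = \<Psi> t" if "t \<in> T" for t
  proof -
    have "a t = t" using a[of t] that T by (meson order_antisym order_refl)
    then show ?thesis by (simp add: \<gamma>_def)
  qed
  define \<Phi> where "\<Phi> x = \<gamma> (min x m)" for x
  have m0: "0 \<le> m" using T m by auto
  have \<Phi>mono: "\<Phi> x' - \<Phi> x \<in> psd" if "0 \<le> x" "x \<le> x'" for x x'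
    unfolding \<Phi>_def using \<gamma>mono[of "min x m" "min x' m"] that m0 by auto
  show ?thesis
  proof
    show "\<Phi> x \<in> psd" if "0 \<le> x" for x
      using \<gamma>a[OF T(2), of "min x m"] \<Psi>psd[OF T(2)] that m0
        psd_add[of "\<gamma> (min x m) - \<Psi> 0" "\<Psi> 0"] by (auto simp: \<Phi>_def)
    show "\<Phi> (trace A) = A" if "A \<in> V" for A
    proof -
      have "trace A \<in> T" using that by (simp add: T_def)
      then show ?thesis using m(2) \<gamma>T \<Psi>[OF that] by (simp add: \<Phi>_def min_absorb1)
    qed
    show "trace (\<Phi> x' - \<Phi> x) \<le> x' - x" if "0 \<le> x" "x \<le> x'" for x x'
      using \<gamma>tr[of "min x m"] \<gamma>tr[of "min x' m"] that m0 by (simp add: \<Phi>_def trace_sub)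
  qed (rule \<Phi>mono)
qed

section \<open>Symmetric parts, bump functions and elementary bounds\<close>

text \<open>For p = 1 the identities see a matrix only through its quadratic forms, that is, through
  its symmetric part. Symmetry of the overlaps is a later result.\<close>

definition sym_part :: "real ^ 'k ^ 'k \<Rightarrow> real ^ 'k ^ 'k" where
  "sym_part X = (1 / 2) *\<^sub>R (X + transpose X)"

lemma sym_part_transpose: "sym_part (transpose X) = sym_part X"
  by (simp add: sym_part_def transpose_def vec_eq_iff add.commute)

lemma norm_transpose: "norm (transpose X) = norm (X :: real ^ 'k ^ 'k)"
proof -
  have "transpose X \<bullet> transpose X = (\<Sum>i\<in>UNIV. \<Sum>j\<in>UNIV. X $ j $ i * X $ j $ i)"
    by (simp add: inner_vec_def transpose_def)
  also have "\<dots> = X \<bullet> X"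
    by (subst sum.swap) (simp add: inner_vec_def)
  finally show ?thesis by (simp add: norm_eq_sqrt_inner)
qed

lemma dist_sym_part_le: "dist (sym_part X) (sym_part Y) \<le> dist X Y"
proof -
  have "sym_part X - sym_part Y = (1 / 2) *\<^sub>R ((X - Y) + transpose (X - Y))"
    by (simp add: sym_part_def transpose_def vec_eq_iff algebra_simps)
  then show ?thesis
    using norm_triangle_ineq[of "X - Y" "transpose (X - Y)"] by (simp add: dist_norm norm_transpose)
qed

lemma continuous_on_sym_part [continuous_intros]:
  "continuous_on S f \<Longrightarrow> continuous_on S (\<lambda>x. sym_part (f x))"
  unfolding sym_part_def transpose_def by (intro continuous_intros)

lemma quad_sym_part: "v \<bullet> (sym_part X *v v) = v \<bullet> (X *v v)"
  by (simp add: sym_part_def scaleR_matrix_vector_assoc[symmetric] matrix_vector_mult_add_rdistrib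
      inner_add_right) (metis dot_lmul_matrix inner_commute)

text \<open>A tent that is positive exactly on an open ball. It replaces the indicator because weak
  convergence and exchangeability are available for continuous functions.\<close>

definition bump :: "real \<Rightarrow> 'a::metric_space \<Rightarrow> 'a \<Rightarrow> real" where
  "bump \<epsilon> x y = max 0 (1 - dist x y / \<epsilon>)"

lemma bump_nonneg: "0 \<le> bump \<epsilon> x y"
  and bump_le_1: "0 < \<epsilon> \<Longrightarrow> bump \<epsilon> x y \<le> 1"
  and bump_pos_iff: "0 < \<epsilon> \<Longrightarrow> 0 < bump \<epsilon> x y \<longleftrightarrow> dist x y < \<epsilon>"
  by (auto simp: bump_def field_simps less_max_iff_disj)

lemma continuous_on_bump [continuous_intros]:
  "0 < \<epsilon> \<Longrightarrow> continuous_on S f \<Longrightarrow> continuous_on S (\<lambda>x. bump \<epsilon> (f x) a)"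
  unfolding bump_def by (intro continuous_intros) auto

section \<open>Elementary facts on sums, products and recursions\<close>

lemma prod_pos_iff_nonneg:
  fixes f :: "'a \<Rightarrow> real"
  assumes "finite S" "\<And>x. x \<in> S \<Longrightarrow> 0 \<le> f x"
  shows "0 < prod f S \<longleftrightarrow> (\<forall>x\<in>S. 0 < f x)"
  using assms prod_nonneg[of S f] prod_zero_iff[of S f] by (force simp: less_le)

lemma sum_pos_iff_nonneg:
  fixes f :: "'a \<Rightarrow> real"
  assumes "finite S" "\<And>x. x \<in> S \<Longrightarrow> 0 \<le> f x"
  shows "0 < sum f S \<longleftrightarrow> (\<exists>x\<in>S. 0 < f x)"
  using assms sum_nonneg[of S f] sum_nonneg_eq_0_iff[of S f] by (force simp: less_le)

text \<open>The sum is the probability that exactly one of independent events with probabilities \<open>h p\<close> occurs.\<close>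

lemma sum_exactly_one_le_1:
  fixes h :: "'a \<Rightarrow> real"
  assumes "finite P" "\<And>p. p \<in> P \<Longrightarrow> 0 \<le> h p \<and> h p \<le> 1"
  shows "(\<Sum>p\<in>P. h p * (\<Prod>q\<in>P - {p}. 1 - h q)) \<le> 1"
proof -
  have "(\<Sum>p\<in>P. h p * (\<Prod>q\<in>P - {p}. 1 - h q)) + (\<Prod>q\<in>P. 1 - h q) \<le> 1"
    using assms
  proof (induction P rule: finite_induct)
    case (insert a P)
    let ?S = "\<Sum>p\<in>P. h p * (\<Prod>q\<in>P - {p}. 1 - h q)" and ?P = "\<Prod>q\<in>P. 1 - h q"
    have "(\<Prod>q\<in>insert a P - {p}. 1 - h q) = (1 - h a) * (\<Prod>q\<in>P - {p}. 1 - h q)" if "p \<in> P" for p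
    proof -
      have "insert a P - {p} = insert a (P - {p})" "a \<notin> P - {p}" using that insert by auto
      then show ?thesis using insert by simp
    qed
    then have "(\<Sum>p\<in>P. h p * (\<Prod>q\<in>insert a P - {p}. 1 - h q)) = (1 - h a) * ?S"
      unfolding sum_distrib_left by (intro sum.cong) (simp_all only: mult.left_commute)
    then have "(\<Sum>p\<in>insert a P. h p * (\<Prod>q\<in>insert a P - {p}. 1 - h q)) = h a * ?P + (1 - h a) * ?S"
      using insert by simp
    moreover have "0 \<le> ?S" using insert by (intro sum_nonneg mult_nonneg_nonneg prod_nonneg) auto
    moreover have "(1 - h a) * ?S \<le> 1 * ?S"
      using insert.prems \<open>0 \<le> ?S\<close> by (intro mult_right_mono) auto
    moreover have "(\<Prod>q\<in>insert a P. 1 - h q) = (1 - h a) * ?P" using insert by simp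
    moreover have "?S + ?P \<le> 1" using insert by simp
    moreover have "h a * ?P + (1 - h a) * ?P = ?P" by (simp add: left_diff_distrib)
    ultimately show ?case by linarith
  qed simp
  moreover have "0 \<le> (\<Prod>q\<in>P. 1 - h q)" using assms by (intro prod_nonneg) auto
  ultimately show ?thesis by linarith
qed

text \<open>With \<open>y k = (n + k - 1) * x k\<close> the recursion reads
  \<open>y (k + 1) = y k + p * x k\<close>. So \<open>y\<close> increases and \<open>x k\<close> is
  at least a constant times 1 / (n + k - 1), while \<open>upper\<close> keeps \<open>y\<close>, and
  with it the sum of all \<open>x k\<close>, bounded. The harmonic series diverges.\<close>

lemma GG_recursion_contradiction:
  fixes x :: "nat \<Rightarrow> real"
  assumes "2 \<le> n" "0 < p" "0 < x 0"
    and rec: "\<And>k. x (Suc k) = x k * (real n + real k - 1 + p) / (real n + real k)"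
    and upper: "\<And>k. x k \<le> 1 / (real k + 1)"
  shows False
proof -
  define y where "y k = (real n + real k - 1) * x k" for k
  have pos: "0 < x k" for k
    by (induction k) (use assms in auto)
  have step: "y (Suc k) = y k + p * x k" for k
    using \<open>2 \<le> n\<close> by (simp add: y_def rec field_simps)
  have y0: "0 < y 0" using assms by (simp add: y_def)
  have ymono: "y 0 \<le> y k" for k
    by (induction k) (use step pos \<open>0 < p\<close> in \<open>auto intro: order_trans simp: less_imp_le\<close>)
  have yle: "y k \<le> real n" for k
  proof -
    have "y k \<le> (real n + real k - 1) * (1 / (real k + 1))"
      unfolding y_def using upper \<open>2 \<le> n\<close> by (intro mult_left_mono) auto
    also have "\<dots> \<le> real n"
      using \<open>2 \<le> n\<close> mult_right_mono[of 1 "real n" "real k"] by (simp add: field_simps)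
    finally show ?thesis .
  qed
  have psum: "(\<Sum>j<k. p * x j) = y k - y 0" for k
    by (induction k) (simp_all add: step)
  have "summable (\<lambda>k. p * x k)"
  proof (rule bounded_imp_summable)
    show "0 \<le> p * x k" for k using pos[of k] \<open>0 < p\<close> by simp
    show "(\<Sum>j\<le>k. p * x j) \<le> real n" for k
      using psum[of "Suc k"] yle[of "Suc k"] y0 by (simp add: lessThan_Suc_atMost)
  qed
  then have "summable (\<lambda>k. (1 / (p * y 0)) * (p * x k))" by (rule summable_mult)
  moreover have "norm (inverse (real (k + (n - 1)))) \<le> (1 / (p * y 0)) * (p * x k)" for k
  proof -
    have "real (k + (n - 1)) = real n + real k - 1" using \<open>2 \<le> n\<close> by (simp add: of_nat_diff)
    moreover have "1 / (real n + real k - 1) \<le> x k / y 0"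
      using ymono[of k] y0 \<open>2 \<le> n\<close> by (simp add: y_def[of k] pos_divide_le_eq le_divide_eq mult.commute)
    moreover have "(1 / (p * y 0)) * (p * x k) = x k / y 0" using \<open>0 < p\<close> by simp
    moreover have "0 \<le> 1 / (real n + real k - 1)" using \<open>2 \<le> n\<close> by simp
    ultimately show ?thesis by (simp only: inverse_eq_divide real_norm_def abs_of_nonneg)
  qed
  ultimately have "summable (\<lambda>k. inverse (real (k + (n - 1))))"
    by (rule summable_comparison_test'[where N = 0])
  then show False
    unfolding summable_iff_shift[of "\<lambda>k. inverse (real k)"] using not_summable_harmonic[where 'a = real] by simp
qed

lemma slope_nonneg_of_linear_bound:
  fixes a b :: real
  assumes "\<And>M :: nat. 0 \<le> a * real M + b" shows "0 \<le> a"
proof (rule ccontr)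
  assume "\<not> 0 \<le> a"
  then obtain M :: nat where "b / (- a) < real M" using reals_Archimedean2 by blast
  then have "a * real M + b < 0" using \<open>\<not> 0 \<le> a\<close> by (simp add: field_simps)
  then show False using assms[of M] by simp
qed

text \<open>For sums over replicas that are split into two groups by the parity of the index; in
  \<open>sum_parity_Suc\<close> replica 1 is set apart.\<close>

lemma sum_parity: "(\<Sum>i\<in>{1..2 * M}. if odd i then a else b) = real M * (a + b)" for a b :: real
  by (induction M) (simp_all add: algebra_simps)

lemma sum_parity_Suc:
  "(\<Sum>i\<in>{1..2 * M + 1}. if i = 1 then a else if even i then b else c) = a + real M * (b + c)"
  for a b c :: real
  by (induction M) (simp_all add: algebra_simps)

lemma LIMSEQ_dist_less_inverse:
  assumes "\<And>k. dist (X k) a < inverse (real (Suc k))" shows "X \<longlonglongrightarrow> a"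
  by (rule metric_tendsto_imp_tendsto[OF LIMSEQ_inverse_real_of_nat])
    (use assms in \<open>auto intro!: always_eventually less_imp_le\<close>)

section \<open>Support of a random array\<close>

type_synonym 'k overlap_array = "nat \<times> nat \<Rightarrow> real ^ 'k ^ 'k"

abbreviation swap :: "nat \<Rightarrow> nat \<Rightarrow> nat \<Rightarrow> nat" where
  "swap \<equiv> Transposition.transpose"

definition relabel :: "(nat \<Rightarrow> nat) \<Rightarrow> 'k::finite overlap_array \<Rightarrow> 'k overlap_array" where
  "relabel \<tau> A = (\<lambda>(i, j). A (\<tau> i, \<tau> j))"

lemma relabel_apply [simp]: "relabel \<tau> A (i, j) = A (\<tau> i, \<tau> j)"
  by (simp add: relabel_def)

text \<open>Functions of a finite block are kept as functions of the whole array, which avoids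
  extensional product spaces.\<close>

definition local_on :: "nat \<Rightarrow> ('k::finite overlap_array \<Rightarrow> 'b) \<Rightarrow> bool" where
  "local_on n F \<longleftrightarrow> (\<forall>R R'. (\<forall>x\<in>block n. R x = R' x) \<longrightarrow> F R = F R')"

definition cylinder :: "nat \<Rightarrow> real \<Rightarrow> 'k::finite overlap_array \<Rightarrow> 'k overlap_array set" where
  "cylinder n \<epsilon> A = {R. \<forall>x\<in>block n. dist (R x) (A x) < \<epsilon>}"

text \<open>Only indices \<open>\<ge> 1\<close> are constrained: the other entries of an array carry no information.\<close>

definition array_support :: "'k::finite overlap_array measure \<Rightarrow> 'k overlap_array set" where
  "array_support \<nu> = {A. \<forall>n. \<forall>\<epsilon>>0. 0 < measure \<nu> (cylinder n \<epsilon> A)}"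

lemma finite_block [simp]: "finite (block n)"
  by (simp add: block_def)

lemma continuous_on_entry [continuous_intros]: "continuous_on S (\<lambda>R. (R :: 'k::finite overlap_array) x)"
  by (rule continuous_on_subset[OF continuous_on_product_coordinates subset_UNIV])

lemma open_cylinder: "open (cylinder n \<epsilon> A)"
proof -
  have "cylinder n \<epsilon> A = (\<Inter>x\<in>block n. {R. dist (R x) (A x) < \<epsilon>})"
    by (auto simp: cylinder_def)
  then show ?thesis
    by (auto intro!: open_INT open_Collect_less continuous_intros)
qed

definition cyl_bump :: "nat \<Rightarrow> real \<Rightarrow> 'k::finite overlap_array \<Rightarrow> 'k overlap_array \<Rightarrow> real" where
  "cyl_bump n \<epsilon> A R = (\<Prod>x\<in>block n. bump \<epsilon> (R x) (A x))"

lemma cyl_bump_nonneg: "0 \<le> cyl_bump n \<epsilon> A R"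
  and cyl_bump_le_1: "0 < \<epsilon> \<Longrightarrow> cyl_bump n \<epsilon> A R \<le> 1"
  and cyl_bump_pos_iff: "0 < \<epsilon> \<Longrightarrow> 0 < cyl_bump n \<epsilon> A R \<longleftrightarrow> R \<in> cylinder n \<epsilon> A"
  by (auto simp: cyl_bump_def bump_nonneg bump_le_1 bump_pos_iff cylinder_def prod_pos_iff_nonneg
      intro!: prod_nonneg prod_le_1)

lemma continuous_on_cyl_bump: "0 < \<epsilon> \<Longrightarrow> continuous_on S (cyl_bump n \<epsilon> A)"
  unfolding cyl_bump_def by (intro continuous_intros)

lemma local_on_cyl_bump: "local_on n (cyl_bump n \<epsilon> A)"
  by (simp add: local_on_def cyl_bump_def)

text \<open>The law lives on the Borel sets of the full function space, which is second countable;
  entries with a zero index are carried along.\<close>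

locale random_array = prob_space \<nu> for \<nu> :: "'k::finite overlap_array measure" +
  assumes sets_eq: "sets \<nu> = sets borel"
begin

lemma space_UNIV [simp]: "space \<nu> = UNIV"
  using sets_eq_imp_space_eq[OF sets_eq] by simp

lemma measurable_iff: "f \<in> borel_measurable \<nu> \<longleftrightarrow> f \<in> borel_measurable borel"
  using measurable_cong_sets[OF sets_eq refl] by blast

lemma integrable_bounded:
  fixes f :: "'k overlap_array \<Rightarrow> real"
  assumes "f \<in> borel_measurable borel" "\<And>R. \<bar>f R\<bar> \<le> C"
  shows "integrable \<nu> f"
  using assms by (intro integrable_const_bound[where B = C]) (auto simp: measurable_iff)

lemma integral_pos_iff:
  fixes f :: "'k overlap_array \<Rightarrow> real"
  assumes "f \<in> borel_measurable borel" "\<And>R. 0 \<le> f R" "\<And>R. f R \<le> C"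
  shows "0 < (\<integral>R. f R \<partial>\<nu>) \<longleftrightarrow> \<not> (AE R in \<nu>. f R = 0)"
proof -
  have "integrable \<nu> f" using assms by (intro integrable_bounded[of _ C]) auto
  then have "(\<integral>R. f R \<partial>\<nu>) = 0 \<longleftrightarrow> (AE R in \<nu>. f R = 0)"
    using assms by (intro integral_nonneg_eq_0_iff_AE) auto
  moreover have "0 \<le> (\<integral>R. f R \<partial>\<nu>)" using assms by (intro integral_nonneg_AE) auto
  ultimately show ?thesis by linarith
qed

lemma measure_pos_iff:
  assumes "S \<in> sets borel" shows "0 < measure \<nu> S \<longleftrightarrow> \<not> (AE R in \<nu>. R \<notin> S)"
  using assms prob_eq_0[of S] sets_eq by (auto simp: zero_less_measure_iff less_le)

text \<open>Every array outside the support lies in a null cylinder, hence in a null member of a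
  countable basis.\<close>

lemma AE_array_support: "AE R in \<nu>. R \<in> array_support \<nu>"
proof -
  obtain B :: "'k overlap_array set set" where B: "countable B" "topological_basis B"
    using ex_countable_basis by blast
  define N where "N = \<Union> {U \<in> B. U \<in> null_sets \<nu>}"
  have "N \<in> null_sets \<nu>"
    unfolding N_def using B(1) by (intro null_sets_UN'[of _ "\<lambda>x. x", simplified]) auto
  moreover have "R \<in> N" if "R \<notin> array_support \<nu>" for R
  proof -
    from that obtain n \<epsilon> where \<epsilon>: "0 < \<epsilon>" and 0: "measure \<nu> (cylinder n \<epsilon> R) \<le> 0"
      by (auto simp: array_support_def not_less)
    have R: "R \<in> cylinder n \<epsilon> R" using \<epsilon> by (simp add: cylinder_def)
    then obtain U where U: "U \<in> B" "R \<in> U" "U \<subseteq> cylinder n \<epsilon> R"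
      using topological_basisE[OF B(2) open_cylinder] by metis
    have "cylinder n \<epsilon> R \<in> null_sets \<nu>"
      using 0 measure_nonneg[of \<nu>] open_cylinder[of n \<epsilon> R]
      by (auto simp: null_sets_def sets_eq emeasure_eq_measure intro: antisym)
    then have "U \<in> null_sets \<nu>"
      using U topological_basis_open[OF B(2)] by (auto simp: sets_eq intro: null_sets_subset)
    then show ?thesis using U by (auto simp: N_def)
  qed
  ultimately show ?thesis by (auto intro: AE_I')
qed

text \<open>Integrals of continuous functions are the form in which exchangeability and weak
  convergence can be applied to the support.\<close>

lemma support_cyl_bump:
  "A \<in> array_support \<nu> \<longleftrightarrow> (\<forall>n. \<forall>\<epsilon>>0. 0 < (\<integral>R. cyl_bump n \<epsilon> A R \<partial>\<nu>))"
proof -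
  have "0 < (\<integral>R. cyl_bump n \<epsilon> A R \<partial>\<nu>) \<longleftrightarrow> 0 < measure \<nu> (cylinder n \<epsilon> A)" if "0 < \<epsilon>" for n \<epsilon>
  proof -
    have "0 < (\<integral>R. cyl_bump n \<epsilon> A R \<partial>\<nu>) \<longleftrightarrow> \<not> (AE R in \<nu>. cyl_bump n \<epsilon> A R = 0)"
      using that
      by (intro integral_pos_iff[of _ 1] borel_measurable_continuous_onI continuous_on_cyl_bump
          cyl_bump_nonneg cyl_bump_le_1)
    also have "\<dots> \<longleftrightarrow> \<not> (AE R in \<nu>. R \<notin> cylinder n \<epsilon> A)"
      using cyl_bump_pos_iff[OF that, of n A] cyl_bump_nonneg[of n \<epsilon> A]
      by (intro arg_cong[of _ _ Not] AE_cong) (metis less_eq_real_def less_irrefl)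
    also have "\<dots> \<longleftrightarrow> 0 < measure \<nu> (cylinder n \<epsilon> A)"
      by (rule measure_pos_iff[symmetric]) (simp add: open_cylinder)
    finally show ?thesis .
  qed
  then show ?thesis by (auto simp: array_support_def)
qed

lemma integral_pos_support:
  fixes f :: "'k overlap_array \<Rightarrow> real"
  assumes "f \<in> borel_measurable borel" "\<And>R. 0 \<le> f R" "\<And>R. f R \<le> C"
    and "A \<in> array_support \<nu>" "0 < \<epsilon>" "\<And>R. R \<in> cylinder n \<epsilon> A \<Longrightarrow> 0 < f R"
  shows "0 < (\<integral>R. f R \<partial>\<nu>)"
proof -
  have "0 < measure \<nu> (cylinder n \<epsilon> A)"
    using assms by (simp add: array_support_def)
  then have "\<not> (AE R in \<nu>. R \<notin> cylinder n \<epsilon> A)"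
    by (subst (asm) measure_pos_iff) (auto simp: open_cylinder)
  moreover have "AE R in \<nu>. R \<notin> cylinder n \<epsilon> A" if "AE R in \<nu>. f R = 0"
    using that by eventually_elim (use assms(6) in force)
  ultimately have "\<not> (AE R in \<nu>. f R = 0)" by blast
  then show ?thesis using integral_pos_iff[of f C] assms by simp
qed

text \<open>Tychonoff's theorem gives a convergent subsequence, and the support is closed: the
  cylinder of half the radius around a late term lies in the cylinder around the limit.\<close>

lemma support_limit:
  fixes A :: "nat \<Rightarrow> 'k overlap_array"
  assumes A: "\<And>k. A k \<in> array_support \<nu>"
    and bound: "\<And>k i j. 1 \<le> i \<Longrightarrow> 1 \<le> j \<Longrightarrow> norm (A k (i, j)) \<le> C"
  obtains L r where "L \<in> array_support \<nu>" "strict_mono r"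
    "\<And>i j. 1 \<le> i \<Longrightarrow> 1 \<le> j \<Longrightarrow> (\<lambda>k. A (r k) (i, j)) \<longlonglongrightarrow> L (i, j)"
proof -
  \<comment> \<open>Entries with a zero index may be unbounded, so they are set to 0 before
    compactness is used.\<close>
  define B where "B k = (\<lambda>(i, j). if 1 \<le> i \<and> 1 \<le> j then A k (i, j) else 0)" for k
  define K where "K = (\<Pi>\<^sub>E x\<in>(UNIV :: (nat \<times> nat) set). cball (0 :: real ^ 'k ^ 'k) \<bar>C\<bar>)"
  have "compactin (product_topology (\<lambda>x. euclidean) UNIV) K"
    unfolding K_def by (subst compactin_PiE) auto
  then have "compact K"
    by (simp add: euclidean_product_topology compactin_euclidean_iff)
  moreover have "B k \<in> K" for k
    using order_trans[OF bound abs_ge_self] by (auto simp: B_def K_def PiE_iff)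
  ultimately obtain L r where L: "strict_mono r" "(B \<circ> r) \<longlonglongrightarrow> L"
    using compact_imp_seq_compact[of K] unfolding seq_compact_def by metis
  have conv: "(\<lambda>k. A (r k) (i, j)) \<longlonglongrightarrow> L (i, j)" if "1 \<le> i" "1 \<le> j" for i j
  proof -
    have "isCont (\<lambda>R :: 'k overlap_array. R (i, j)) L"
      using continuous_on_entry[of UNIV "(i, j)"] continuous_on_eq_continuous_at[OF open_UNIV] by blast
    from isCont_tendsto_compose[OF this L(2)] show ?thesis using that by (simp add: B_def)
  qed
  moreover have "L \<in> array_support \<nu>"
    unfolding array_support_def
  proof (intro CollectI allI impI)
    fix n and \<epsilon> :: real assume "0 < \<epsilon>"
    have "\<forall>\<^sub>F k in sequentially. \<forall>x\<in>block n. dist (A (r k) x) (L x) < \<epsilon> / 2"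
    proof (intro eventually_ball_finite finite_block ballI)
      fix x assume "x \<in> block n"
      then show "\<forall>\<^sub>F k in sequentially. dist (A (r k) x) (L x) < \<epsilon> / 2"
        using tendstoD[OF conv, of "fst x" "snd x" "\<epsilon> / 2"] \<open>0 < \<epsilon>\<close> by (cases x) (auto simp: block_def)
    qed
    then obtain k where k: "\<forall>x\<in>block n. dist (A (r k) x) (L x) < \<epsilon> / 2"
      by (auto simp: eventually_sequentially)
    have "cylinder n (\<epsilon> / 2) (A (r k)) \<subseteq> cylinder n \<epsilon> L"
      using k unfolding cylinder_def by (force intro: dist_triangle_half_r simp: dist_commute)
    then have "measure \<nu> (cylinder n (\<epsilon> / 2) (A (r k))) \<le> measure \<nu> (cylinder n \<epsilon> L)"
      by (intro finite_measure_mono) (auto simp: sets_eq open_cylinder)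
    moreover have "0 < measure \<nu> (cylinder n (\<epsilon> / 2) (A (r k)))"
      using A \<open>0 < \<epsilon>\<close> by (simp add: array_support_def)
    ultimately show "0 < measure \<nu> (cylinder n \<epsilon> L)" by linarith
  qed
  ultimately show ?thesis using that L(1) by blast
qed

end

section \<open>Duplication of replicas\<close>

text \<open>What the argument uses of the model: exchangeability, the identities for p = 1, and
  relations between overlaps that pass to limits and hence to the support. \<open>D\<close> is the
  common self-overlap, deterministic because the colour proportions are fixed.\<close>

locale GG_array = random_array \<nu> for \<nu> :: "'k::finite overlap_array measure" +
  fixes D :: "real ^ 'k ^ 'k" and B :: real
  assumes exch: "\<And>F C n p q. \<lbrakk>continuous_on UNIV F; \<And>R. \<bar>F R\<bar> \<le> C; local_on n F;
      p \<in> {1..n}; q \<in> {1..n}\<rbrakk> \<Longrightarrow> (\<integral>R. F (relabel (swap p q) R) \<partial>\<nu>) = (\<integral>R. (F R :: real) \<partial>\<nu>)"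
    and GG: "\<And>n f C \<psi> C'. \<lbrakk>2 \<le> n; f \<in> borel_measurable borel; \<And>R. \<bar>f R\<bar> \<le> C; local_on n f;
      \<psi> \<in> borel_measurable borel; \<And>X. \<bar>\<psi> X\<bar> \<le> C'\<rbrakk> \<Longrightarrow>
      (\<integral>R. f R * \<psi> (sym_part (R (1, n + 1))) \<partial>\<nu>) =
        1 / real n * (\<integral>R. (f R :: real) \<partial>\<nu>) * (\<integral>R. (\<psi> (sym_part (R (1, 2))) :: real) \<partial>\<nu>) +
        1 / real n * (\<Sum>l\<in>{2..n}. \<integral>R. f R * \<psi> (sym_part (R (1, l))) \<partial>\<nu>)"
    and support_transpose: "\<And>A i j. \<lbrakk>A \<in> array_support \<nu>; 1 \<le> i; 1 \<le> j\<rbrakk> \<Longrightarrow>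
      A (j, i) = transpose (A (i, j))"
    and support_gram: "\<And>A n x. A \<in> array_support \<nu> \<Longrightarrow>
      0 \<le> (\<Sum>i\<in>{1..n}. \<Sum>j\<in>{1..n}. x i \<bullet> (A (i, j) *v x j))"
    and support_diag: "\<And>A i. \<lbrakk>A \<in> array_support \<nu>; 1 \<le> i\<rbrakk> \<Longrightarrow> A (i, i) = D"
    and support_bounded: "\<And>A i j. \<lbrakk>A \<in> array_support \<nu>; 1 \<le> i; 1 \<le> j\<rbrakk> \<Longrightarrow> norm (A (i, j)) \<le> B"
begin

section \<open>Invariance of the support under transpositions\<close>

lemma support_swap:
  assumes A: "A \<in> array_support \<nu>" and pq: "1 \<le> p" "1 \<le> q"
  shows "relabel (swap p q) A \<in> array_support \<nu>"
  unfolding support_cyl_bump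
proof (intro allI impI)
  fix n and \<epsilon> :: real assume \<epsilon>: "0 < \<epsilon>"
  \<comment> \<open>The block has to contain \<open>p\<close> and \<open>q\<close> in order to be
    mapped to itself by the transposition.\<close>
  define m where "m = max n (max p q)"
  let ?\<tau> = "swap p q"
  let ?F = "cyl_bump m \<epsilon> (relabel ?\<tau> A)"
  have bij: "bij_betw (\<lambda>(i, j). (?\<tau> i, ?\<tau> j)) (block m) (block m)"
    by (intro bij_betw_byWitness[where f' = "\<lambda>(i, j). (?\<tau> i, ?\<tau> j)"])
      (use pq in \<open>auto simp: block_def m_def Transposition.transpose_def\<close>)
  have "?F (relabel ?\<tau> R) = cyl_bump m \<epsilon> A R" for R
    using prod.reindex_bij_betw[OF bij, of "\<lambda>x. bump \<epsilon> (R x) (A x)"]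
    by (simp add: cyl_bump_def relabel_def case_prod_unfold)
  then have "(\<integral>R. cyl_bump m \<epsilon> A R \<partial>\<nu>) = (\<integral>R. ?F (relabel ?\<tau> R) \<partial>\<nu>)"
    by simp
  also have "\<dots> = (\<integral>R. ?F R \<partial>\<nu>)"
    using \<epsilon> pq by (intro exch[of _ 1 m] continuous_on_cyl_bump local_on_cyl_bump)
      (auto simp: cyl_bump_nonneg cyl_bump_le_1 m_def)
  \<comment> \<open>Shrinking the block only drops factors between 0 and 1.\<close>
  also have "\<dots> \<le> (\<integral>R. cyl_bump n \<epsilon> (relabel ?\<tau> A) R \<partial>\<nu>)"
  proof (rule integral_mono)
    show "?F R \<le> cyl_bump n \<epsilon> (relabel ?\<tau> A) R" for R
    proof -
      have "block n \<subseteq> block m" by (auto simp: block_def m_def)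
      then show ?thesis
        unfolding cyl_bump_def using \<epsilon>
        by (subst prod.subset_diff[of "block n"])
          (auto intro!: mult_left_le_one_le prod_nonneg prod_le_1 simp: bump_nonneg bump_le_1)
    qed
  qed (use \<epsilon> in \<open>auto intro!: integrable_bounded[of _ 1] borel_measurable_continuous_onI
      continuous_on_cyl_bump simp: cyl_bump_nonneg cyl_bump_le_1\<close>)
  finally show "0 < (\<integral>R. cyl_bump n \<epsilon> (relabel ?\<tau> A) R \<partial>\<nu>)"
    using A \<epsilon> unfolding support_cyl_bump by (meson less_le_trans)
qed

section \<open>Existence of an approximate twin\<close>

text \<open>In the proof, \<open>x k\<close> is the (smoothed) probability that replicas \<open>1..n\<close> look like \<open>A\<close> and none of
  \<open>n + 1..n + k\<close> has an overlap with replica \<open>1\<close> away from the values \<open>A (1, i)\<close>. The identities give an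
  exact recursion for \<open>x\<close>; if no twin of replica \<open>1\<close> exists, exchangeability gives the upper bound.\<close>

lemma duplication_approx:
  assumes A: "A \<in> array_support \<nu>" and n: "2 \<le> n" and \<epsilon>: "0 < \<epsilon>"
  shows "\<exists>A'\<in>array_support \<nu>.
    (\<forall>i\<in>{2..n}. \<forall>j\<in>{2..n}. dist (A' (i, j)) (A (i, j)) < \<epsilon>) \<and>
    (\<forall>i\<in>{2..n}. dist (A' (1, i)) (A (1, i)) < \<epsilon> \<and> dist (A' (n + 1, i)) (A (1, i)) < \<epsilon>) \<and>
    (\<exists>i\<in>{2..n}. dist (sym_part (A' (1, n + 1))) (sym_part (A (1, i))) < \<epsilon>)"
proof (rule ccontr)
  assume contra: "\<not> ?thesis"
  \<comment> \<open>A smoothed indicator that replicas \<open>2..n\<close> have the overlaps of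
    \<open>A\<close> among themselves and that replica \<open>p\<close> has with them the overlaps
    of replica 1 of \<open>A\<close>.\<close>
  define h where "h p R = (\<Prod>x\<in>{2..n} \<times> {2..n}. bump \<epsilon> (R x) (A x)) *
    (\<Prod>i\<in>{2..n}. bump \<epsilon> (R (p, i)) (A (1, i)))" for p :: nat and R :: "'k overlap_array"
  \<comment> \<open>\<open>C\<close> is the neighbourhood of the existing values; \<open>c\<close>
    is a continuous function that is positive exactly on \<open>C\<close>, as required for
    exchangeability.\<close>
  define C where "C = {Y. \<exists>i\<in>{2..n}. dist Y (sym_part (A (1, i))) < \<epsilon>}"
  define c where "c Y = (\<Sum>i\<in>{2..n}. bump \<epsilon> Y (sym_part (A (1, i))))" for Y
  \<comment> \<open>Positive exactly if replicas 1 and \<open>n + j\<close> both look like replica 1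
    of \<open>A\<close> and their mutual overlap falls into \<open>C\<close>.\<close>
  define G where "G j R = h 1 R * h (n + j) R * c (sym_part (R (1, n + j)))" for j R
  have h: "0 \<le> h p R" "h p R \<le> 1" for p R
    unfolding h_def using \<epsilon>
    by (auto intro!: mult_nonneg_nonneg mult_le_one prod_nonneg prod_le_1 simp: bump_nonneg bump_le_1)
  have h_pos: "0 < h p R \<longleftrightarrow> (\<forall>i\<in>{2..n}. \<forall>j\<in>{2..n}. dist (R (i, j)) (A (i, j)) < \<epsilon>) \<and>
      (\<forall>i\<in>{2..n}. dist (R (p, i)) (A (1, i)) < \<epsilon>)" for p R
  proof -
    have nn: "0 \<le> (\<Prod>x\<in>{2..n} \<times> {2..n}. bump \<epsilon> (R x) (A x))"
      "0 \<le> (\<Prod>i\<in>{2..n}. bump \<epsilon> (R (p, i)) (A (1, i)))" by (intro prod_nonneg ballI bump_nonneg)+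
    then have "0 < h p R \<longleftrightarrow> 0 < (\<Prod>x\<in>{2..n} \<times> {2..n}. bump \<epsilon> (R x) (A x)) \<and>
      0 < (\<Prod>i\<in>{2..n}. bump \<epsilon> (R (p, i)) (A (1, i)))"
      unfolding h_def by (auto simp: zero_less_mult_iff)
    then show ?thesis using \<epsilon>
      by (simp add: prod_pos_iff_nonneg bump_nonneg bump_pos_iff)
  qed
  have h_cont: "continuous_on S (h p)" for p S
    unfolding h_def using \<epsilon> by (intro continuous_intros)
  have c: "0 \<le> c Y" "c Y \<le> real n" "0 < c Y \<longleftrightarrow> Y \<in> C" for Y
  proof -
    show "0 \<le> c Y" unfolding c_def by (intro sum_nonneg bump_nonneg)
    show "0 < c Y \<longleftrightarrow> Y \<in> C"
      unfolding c_def C_def by (simp add: sum_pos_iff_nonneg bump_nonneg bump_pos_iff \<epsilon>)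
    have "c Y \<le> (\<Sum>i\<in>{2..n}. 1)" unfolding c_def using \<epsilon> by (intro sum_mono bump_le_1)
    also have "\<dots> \<le> real n" by simp
    finally show "c Y \<le> real n" .
  qed
  have C_open: "open C"
  proof -
    have "C = (\<Union>i\<in>{2..n}. ball (sym_part (A (1, i))) \<epsilon>)" by (auto simp: C_def dist_commute)
    then show ?thesis by auto
  qed
  have G_cont: "continuous_on UNIV (G j)" for j
    unfolding G_def c_def using \<epsilon> by (intro continuous_intros h_cont)
  have G_nonneg: "0 \<le> G j R" and G_le: "G j R \<le> real n" for j R
  proof -
    show "0 \<le> G j R" unfolding G_def using h c by simp
    have "h 1 R * h (n + j) R * c (sym_part (R (1, n + j))) \<le> 1 * real n"
      using h c by (intro mult_mono mult_le_one mult_nonneg_nonneg) auto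
    then show "G j R \<le> real n" by (simp add: G_def)
  qed
  have h_local: "local_on m (h p)" if "n \<le> m" "1 \<le> p" "p \<le> m" for m p
    unfolding local_on_def h_def
    by (intro allI impI arg_cong2[where f = "(*)"] prod.cong refl) (use that in \<open>auto simp: block_def\<close>)
  have G_local: "local_on (n + j) (G j)" if "1 \<le> j" for j
    unfolding local_on_def
  proof (intro allI impI)
    fix R R' :: "'k overlap_array" assume R: "\<forall>x\<in>block (n + j). R x = R' x"
    have "h 1 R = h 1 R'" "h (n + j) R = h (n + j) R'"
      using h_local[of "n + j" 1] h_local[of "n + j" "n + j"] R that unfolding local_on_def by auto
    moreover have "R (1, n + j) = R' (1, n + j)" using R that by (auto simp: block_def)
    ultimately show "G j R = G j R'" by (simp add: G_def)
  qed
  have h_swap: "h p (relabel (swap a b) R) = h (swap a b p) R"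
    if "a \<notin> {2..n}" "b \<notin> {2..n}" for a b p R
  proof -
    have "swap a b i = i" if "i \<in> {2..n}" for i
      using that \<open>a \<notin> {2..n}\<close> \<open>b \<notin> {2..n}\<close> by (auto simp: Transposition.transpose_def)
    then show ?thesis
      unfolding h_def by (intro arg_cong2[where f = "(*)"] prod.cong) auto
  qed
  \<comment> \<open>The assumption excludes a twin at \<open>n + 1\<close>; exchangeability carries
    this over to every \<open>n + j\<close>.\<close>
  have G_null: "AE R in \<nu>. \<forall>j\<ge>1. G j R = 0"
  proof -
    have "AE R in \<nu>. G 1 R = 0"
      using AE_array_support
    proof eventually_elim
      case (elim R)
      then have "\<not> (0 < h 1 R \<and> 0 < h (n + 1) R \<and> 0 < c (sym_part (R (1, n + 1))))"
        using contra unfolding h_pos c C_def by auto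
      then show ?case
        using h[of 1 R] h[of "n + 1" R] c(1)[of "sym_part (R (1, n + 1))"]
        by (auto simp: G_def less_le)
    qed
    then have G1: "\<not> 0 < (\<integral>R. G 1 R \<partial>\<nu>)"
      using G_cont[of 1] G_nonneg G_le
      by (subst integral_pos_iff[of _ "real n"]) (auto intro: borel_measurable_continuous_onI)
    have "AE R in \<nu>. G j R = 0" if "1 \<le> j" for j
    proof -
      have "G j (relabel (swap (n + 1) (n + j)) R) = G 1 R" for R
        using n that h_swap[of "n + 1" "n + j"] by (simp add: G_def Transposition.transpose_def)
      then have "(\<integral>R. G 1 R \<partial>\<nu>) = (\<integral>R. G j (relabel (swap (n + 1) (n + j)) R) \<partial>\<nu>)"
        by simp
      also have "\<dots> = (\<integral>R. G j R \<partial>\<nu>)"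
        by (intro exch[of _ "real n" "n + j"] G_cont G_local) (use that G_nonneg G_le in auto)
      finally have "\<not> 0 < (\<integral>R. G j R \<partial>\<nu>)" using G1 by simp
      then show ?thesis
        using G_cont[of j] G_nonneg G_le
        by (subst (asm) integral_pos_iff[of _ "real n"]) (auto intro: borel_measurable_continuous_onI)
    qed
    then show ?thesis by (subst AE_all_countable) auto
  qed
  let ?I = "\<lambda>l (R :: 'k overlap_array). indicator C (sym_part (R (1, l))) :: real"
  \<comment> \<open>The indicator of \<open>C\<close> takes the place of \<open>c\<close> here:
    being idempotent, it makes the recursion exact.\<close>
  define f where "f k R = h 1 R * (\<Prod>j\<in>{1..k}. ?I (n + j) R)" for k R
  define x where "x k = (\<integral>R. f k R \<partial>\<nu>)" for k
  have ind_meas: "?I l \<in> borel_measurable borel" for l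
    by (rule measurable_compose[OF _ borel_measurable_indicator])
      (use C_open in \<open>auto intro!: borel_measurable_continuous_onI continuous_intros\<close>)
  have f_meas: "f k \<in> borel_measurable borel" for k
    unfolding f_def
    by (intro borel_measurable_times borel_measurable_prod ind_meas
        borel_measurable_continuous_onI[OF h_cont])
  have f_bd: "0 \<le> f k R" "f k R \<le> 1" for k R
    unfolding f_def using h
    by (auto intro!: mult_nonneg_nonneg mult_le_one prod_nonneg prod_le_1)
  have f_local: "local_on (n + k) (f k)" for k
    unfolding local_on_def f_def
  proof (intro allI impI arg_cong2[where f = "(*)"] prod.cong refl)
    fix R R' :: "'k overlap_array" assume R: "\<forall>x\<in>block (n + k). R x = R' x"
    show "h 1 R = h 1 R'" using h_local[of "n + k" 1] n R by (auto simp: local_on_def)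
    show "?I (n + j) R = ?I (n + j) R'" if "j \<in> {1..k}" for j
      using R n that by (auto simp: block_def)
  qed
  define p where "p = (\<integral>R. ?I 2 R \<partial>\<nu>)"
  have p_pos: "0 < p"
    unfolding p_def
  proof (rule integral_pos_support[of _ 1 A \<epsilon> 2])
    fix R assume "R \<in> cylinder 2 \<epsilon> A"
    then have "dist (sym_part (R (1, 2))) (sym_part (A (1, 2))) < \<epsilon>"
      by (intro le_less_trans[OF dist_sym_part_le]) (auto simp: cylinder_def block_def)
    then have "sym_part (R (1, 2)) \<in> C" using n by (auto simp: C_def)
    then show "0 < ?I 2 R" by simp
  qed (use ind_meas[of 2] A \<epsilon> in auto)
  have x0: "0 < x 0"
    unfolding x_def
  proof (rule integral_pos_support[of _ 1 A \<epsilon> n])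
    show "0 < f 0 R" if "R \<in> cylinder n \<epsilon> A" for R
      using that n h_pos[of 1 R] by (auto simp: cylinder_def block_def f_def)
  qed (use f_meas f_bd A \<epsilon> in auto)
  have rec: "x (Suc k) = x k * (real n + real k - 1 + p) / (real n + real k)" for k
  proof -
    \<comment> \<open>Where \<open>f k\<close> is nonzero, the overlap of 1 and \<open>l\<close> is
      already in \<open>C\<close>: by \<open>h\<close> if \<open>l \<le> n\<close>, by a factor of
      the product otherwise. Each of the \<open>n + k - 1\<close> terms thus reproduces
      \<open>x k\<close>.\<close>
    have absorb: "f k R * ?I l R = f k R" if l: "l \<in> {2..n + k}" for l R
    proof (cases "l \<le> n")
      case True
      have "sym_part (R (1, l)) \<in> C" if "h 1 R \<noteq> 0"
      proof -
        have "0 < h 1 R" using that h(1)[of 1 R] by linarith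
        then have "dist (R (1, l)) (A (1, l)) < \<epsilon>" using l True unfolding h_pos by auto
        then have "dist (sym_part (R (1, l))) (sym_part (A (1, l))) < \<epsilon>"
          by (rule le_less_trans[OF dist_sym_part_le])
        then show ?thesis using l True by (auto simp: C_def)
      qed
      then show ?thesis by (auto simp: f_def)
    next
      case False
      define j where "j = l - n"
      have j: "j \<in> {1..k}" "l = n + j" using l False by (auto simp: j_def)
      then have "(\<Prod>j\<in>{1..k}. ?I (n + j) R) = ?I l R * (\<Prod>j\<in>{1..k} - {j}. ?I (n + j) R)"
        by (subst prod.remove[of _ j]) auto
      then show ?thesis by (auto simp: f_def indicator_def)
    qed
    have "(\<Sum>l\<in>{2..n + k}. \<integral>R. f k R * ?I l R \<partial>\<nu>) = (\<Sum>l\<in>{2..n + k}. x k)"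
      by (intro sum.cong refl) (simp only: absorb x_def)
    also have "\<dots> = (real n + real k - 1) * x k" using n by (simp add: of_nat_diff)
    finally have sum: "(\<Sum>l\<in>{2..n + k}. \<integral>R. f k R * ?I l R \<partial>\<nu>) = (real n + real k - 1) * x k" .
    have "f (Suc k) R = f k R * ?I (n + k + 1) R" for R
      by (simp add: f_def mult.assoc)
    then have "x (Suc k) = (\<integral>R. f k R * ?I (n + k + 1) R \<partial>\<nu>)"
      by (simp add: x_def)
    also have "\<dots> = 1 / real (n + k) * x k * p + 1 / real (n + k) * (\<Sum>l\<in>{2..n + k}. \<integral>R. f k R * ?I l R \<partial>\<nu>)"
      unfolding p_def x_def using n f_bd C_open
      by (intro GG[of "n + k" "f k" 1 "indicator C" 1] f_meas f_local) auto
    finally show ?thesis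
      unfolding sum by (simp add: algebra_simps add_divide_distrib diff_divide_distrib)
  qed
  have upper: "x k \<le> 1 / (real k + 1)" for k
  proof -
    define P where "P = insert 1 {n + 1..n + k}"
    have P: "finite P" "card P = k + 1" "\<And>p. p \<in> P \<Longrightarrow> p \<notin> {2..n}" "\<And>p. p \<in> P \<Longrightarrow> 1 \<le> p \<and> p \<le> n + k"
      "1 \<in> P" using n by (auto simp: P_def)
    \<comment> \<open>The smoothed event that \<open>p\<close> is the only member of
      \<open>P\<close> that looks like replica 1 of \<open>A\<close>. The \<open>k + 1\<close>
      choices of \<open>p\<close> have equal integrals, whose sum is at most 1.\<close>
    define E where "E p R = h p R * (\<Prod>q\<in>P - {p}. 1 - h q R)" for p R
    have E_bd: "0 \<le> E p R" "E p R \<le> 1" for p R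
      unfolding E_def using h by (auto intro!: mult_nonneg_nonneg mult_le_one prod_nonneg prod_le_1)
    have E_cont: "continuous_on UNIV (E p)" for p
      unfolding E_def by (intro continuous_intros h_cont)
    have E_int: "integrable \<nu> (E p)" for p
      using E_bd E_cont by (intro integrable_bounded[of _ 1]) (auto intro: borel_measurable_continuous_onI)
    have E_swap: "(\<integral>R. E p R \<partial>\<nu>) = (\<integral>R. E 1 R \<partial>\<nu>)" if p: "p \<in> P" for p
    proof -
      have "E 1 (relabel (swap 1 p) R) = E p R" for R
      proof -
        have "bij_betw (swap 1 p) (P - {p}) (P - {1})"
          using p P(5) by (intro bij_betw_byWitness[where f' = "swap 1 p"])
            (auto simp: Transposition.transpose_def)
        then have "(\<Prod>q\<in>P - {1}. 1 - h (swap 1 p q) R) = (\<Prod>q\<in>P - {p}. 1 - h q R)"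
          using prod.reindex_bij_betw[of "swap 1 p" "P - {p}" "P - {1}" "\<lambda>q. 1 - h (swap 1 p q) R"]
          by simp
        then show ?thesis using h_swap[of 1 p] p P by (simp add: E_def)
      qed
      then have "(\<integral>R. E p R \<partial>\<nu>) = (\<integral>R. E 1 (relabel (swap 1 p) R) \<partial>\<nu>)" by simp
      also have "\<dots> = (\<integral>R. E 1 R \<partial>\<nu>)"
      proof (rule exch[of _ 1 "n + k"])
        have "h q R = h q R'" if "q \<in> P" "\<forall>x\<in>block (n + k). R x = R' x" for q R R'
          using h_local[of "n + k" q] P(4)[OF that(1)] that(2) by (auto simp: local_on_def)
        then show "local_on (n + k) (E 1)"
          unfolding local_on_def E_def using P(5)
          by (intro allI impI arg_cong2[where f = "(*)"] prod.cong) auto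
      qed (use E_cont E_bd P(4)[OF p] n in auto)
      finally show ?thesis .
    qed
    have "x k \<le> (\<integral>R. E 1 R \<partial>\<nu>)"
      unfolding x_def
    proof (rule integral_mono_AE[OF integrable_bounded[of _ 1] E_int])
      show "AE R in \<nu>. f k R \<le> E 1 R"
        using G_null
      proof eventually_elim
        case (elim R)
        show ?case
        proof (cases "h 1 R = 0 \<or> (\<exists>j\<in>{1..k}. ?I (n + j) R = 0)")
          case True
          then have "f k R = 0" by (auto simp: f_def)
          then show ?thesis using E_bd by simp
        next
          case False
          \<comment> \<open>In \<open>G j R = 0\<close> the other two factors are positive.\<close>
          have "h q R = 0" if "q \<in> P - {1}" for q
          proof -
            define j where "j = q - n"
            have j: "1 \<le> j" "j \<le> k" "q = n + j" using that n by (auto simp: P_def j_def)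
            then have "sym_part (R (1, n + j)) \<in> C" using False by (auto simp: indicator_def split: if_splits)
            then have "0 < c (sym_part (R (1, n + j)))" using c(3) by blast
            then show ?thesis using elim j False by (force simp: G_def)
          qed
          then have "E 1 R = h 1 R" by (simp add: E_def)
          moreover have "f k R \<le> h 1 R * 1"
            unfolding f_def using h by (intro mult_left_mono prod_le_1) auto
          ultimately show ?thesis by simp
        qed
      qed
    qed (use f_meas f_bd in auto)
    also have "(\<integral>R. E 1 R \<partial>\<nu>) = (\<Sum>p\<in>P. \<integral>R. E p R \<partial>\<nu>) / (real k + 1)"
      using E_swap P(2) by (simp add: field_simps)
    also have "(\<Sum>p\<in>P. \<integral>R. E p R \<partial>\<nu>) = (\<integral>R. (\<Sum>p\<in>P. E p R) \<partial>\<nu>)"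
      using E_int by (simp add: Bochner_Integration.integral_sum)
    also have "\<dots> \<le> 1"
    proof (rule integral_le_const)
      show "AE R in \<nu>. (\<Sum>p\<in>P. E p R) \<le> 1"
        unfolding E_def using h P(1) by (intro AE_I2 sum_exactly_one_le_1) auto
    qed (use E_int in auto)
    finally show ?thesis by (simp add: divide_right_mono)
  qed
  show False
    by (rule GG_recursion_contradiction[OF n p_pos x0 rec upper])
qed

text \<open>The twins for \<epsilon> = 1 / (k + 1) converge along a subsequence, and approximate
  equalities become exact. The diagonal and the column of replica 1, on which the approximation is
  silent, come from \<open>support_diag\<close> and \<open>support_transpose\<close>.\<close>

lemma duplication_first:
  assumes A: "A \<in> array_support \<nu>" and n: "2 \<le> n"
  obtains A' where "A' \<in> array_support \<nu>"
    "\<And>i j. i \<in> {1..n} \<Longrightarrow> j \<in> {1..n} \<Longrightarrow> A' (i, j) = A (i, j)"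
    "\<And>i. i \<in> {2..n} \<Longrightarrow> A' (n + 1, i) = A (1, i)"
    "sym_part (A' (1, n + 1)) \<in> (\<lambda>i. sym_part (A (1, i))) ` {2..n}"
proof -
  define F where "F = (\<lambda>i. sym_part (A (1, i))) ` {2..n}"
  have F: "finite F" "F \<noteq> {}" using n by (auto simp: F_def)
  define P where "P \<epsilon> A' \<longleftrightarrow> (\<forall>i\<in>{2..n}. \<forall>j\<in>{2..n}. dist (A' (i, j)) (A (i, j)) < \<epsilon>) \<and>
    (\<forall>i\<in>{2..n}. dist (A' (1, i)) (A (1, i)) < \<epsilon> \<and> dist (A' (n + 1, i)) (A (1, i)) < \<epsilon>) \<and>
    (\<exists>i\<in>{2..n}. dist (sym_part (A' (1, n + 1))) (sym_part (A (1, i))) < \<epsilon>)" for \<epsilon> A'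
  have "\<exists>A'. A' \<in> array_support \<nu> \<and> P (inverse (real (Suc k))) A'" for k
    using duplication_approx[OF A n, of "inverse (real (Suc k))"] unfolding P_def by auto
  then obtain Z where Z: "\<And>k. Z k \<in> array_support \<nu>" and ZP: "\<And>k. P (inverse (real (Suc k))) (Z k)"
    by metis
  have Z1: "dist (Z k (i, j)) (A (i, j)) < inverse (real (Suc k))" if "i \<in> {2..n}" "j \<in> {2..n}" for k i j
    using ZP[of k] that by (simp add: P_def)
  have Z2: "dist (Z k (1, i)) (A (1, i)) < inverse (real (Suc k))"
    "dist (Z k (n + 1, i)) (A (1, i)) < inverse (real (Suc k))" if "i \<in> {2..n}" for k i
    using ZP[of k] that by (simp_all add: P_def)
  obtain L r where L: "L \<in> array_support \<nu>" "strict_mono r"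
    "\<And>i j. 1 \<le> i \<Longrightarrow> 1 \<le> j \<Longrightarrow> (\<lambda>k. Z (r k) (i, j)) \<longlonglongrightarrow> L (i, j)"
    by (rule support_limit[where A = Z, OF Z support_bounded[OF Z]]) (assumption, assumption, rule that)
  have eq: "L (i, j) = a" if "\<And>k. dist (Z k (i, j)) a < inverse (real (Suc k))" "1 \<le> i" "1 \<le> j" for i j a
    using LIMSEQ_unique[OF L(3)[OF that(2,3)]]
      LIMSEQ_subseq_LIMSEQ[OF LIMSEQ_dist_less_inverse[OF that(1)] L(2)] by (simp add: o_def)
  show ?thesis
  proof (rule that[OF L(1)])
    have 2: "L (i, j) = A (i, j)" if "i \<in> {2..n}" "j \<in> {2..n}" for i j
      using that by (intro eq Z1 Z2) auto
    have 1: "L (1, i) = A (1, i)" if "i \<in> {2..n}" for i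
      using that by (intro eq Z1 Z2) auto
    show "L (i, j) = A (i, j)" if ij: "i \<in> {1..n}" "j \<in> {1..n}" for i j
    proof -
      consider "i = 1" "j = 1" | "i = 1" "j \<in> {2..n}" | "j = 1" "i \<in> {2..n}" | "i \<in> {2..n}" "j \<in> {2..n}"
      proof -
        have "i = 1 \<or> i \<in> {2..n}" "j = 1 \<or> j \<in> {2..n}" using ij by auto
        then show ?thesis using that by blast
      qed
      then show ?thesis
      proof cases
        case 1
        then show ?thesis using support_diag[OF L(1)] support_diag[OF A] by simp
      next
        case 3
        then show ?thesis
          using 1[of i] support_transpose[OF L(1), of 1 i] support_transpose[OF A, of 1 i] by simp
      qed (use 1 2 in auto)
    qed
    show "L (n + 1, i) = A (1, i)" if "i \<in> {2..n}" for i
      using that by (intro eq Z1 Z2) auto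
    \<comment> \<open>The nearest existing value may change with \<open>k\<close>, so the distance
      to the whole finite set is followed to the limit.\<close>
    let ?s = "\<lambda>k. infdist (sym_part (Z k (1, n + 1))) F"
    have "norm (?s k) \<le> inverse (real (Suc k))" for k
    proof -
      obtain i where "i \<in> {2..n}" "dist (sym_part (Z k (1, n + 1))) (sym_part (A (1, i))) < inverse (real (Suc k))"
        using ZP[of k] by (auto simp: P_def)
      then show ?thesis
        using infdist_le[of "sym_part (A (1, i))" F "sym_part (Z k (1, n + 1))"]
        by (auto simp: F_def infdist_nonneg)
    qed
    then have "?s \<longlonglongrightarrow> 0"
      by (intro Lim_null_comparison[OF always_eventually LIMSEQ_inverse_real_of_nat]) auto
    then have "(\<lambda>k. ?s (r k)) \<longlonglongrightarrow> 0"
      using LIMSEQ_subseq_LIMSEQ[OF _ L(2)] by (force simp: o_def)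
    moreover have "(\<lambda>k. sym_part (Z (r k) (1, n + 1))) \<longlonglongrightarrow> sym_part (L (1, n + 1))"
      by (rule continuous_on_tendsto_compose[OF continuous_on_sym_part[OF continuous_on_id[of UNIV]]])
        (use L(3) in auto)
    then have "(\<lambda>k. ?s (r k)) \<longlonglongrightarrow> infdist (sym_part (L (1, n + 1))) F"
      by (rule tendsto_infdist)
    ultimately have "infdist (sym_part (L (1, n + 1))) F = 0"
      using LIMSEQ_unique by blast
    then show "sym_part (L (1, n + 1)) \<in> (\<lambda>i. sym_part (A (1, i))) ` {2..n}"
      using in_closed_iff_infdist_zero[OF finite_imp_closed[OF F(1)] F(2)] by (simp only: F_def)
  qed
qed

text \<open>Replica \<open>p\<close> is moved to position 1, duplicated there and moved back; the
  transposition fixes \<open>n + 1\<close>.\<close>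

lemma duplication:
  assumes A: "A \<in> array_support \<nu>" and n: "2 \<le> n" and p: "p \<in> {1..n}"
  obtains A' where "A' \<in> array_support \<nu>"
    "\<And>i j. i \<in> {1..n} \<Longrightarrow> j \<in> {1..n} \<Longrightarrow> A' (i, j) = A (i, j)"
    "\<And>i. i \<in> {1..n} - {p} \<Longrightarrow> A' (n + 1, i) = A (p, i)"
    "sym_part (A' (p, n + 1)) \<in> (\<lambda>i. sym_part (A (p, i))) ` ({1..n} - {p})"
proof -
  let ?\<tau> = "swap 1 p"
  have "relabel ?\<tau> A \<in> array_support \<nu>" using support_swap[OF A, of 1 p] p by simp
  then obtain Z where Z: "Z \<in> array_support \<nu>"
    "\<And>i j. i \<in> {1..n} \<Longrightarrow> j \<in> {1..n} \<Longrightarrow> Z (i, j) = relabel ?\<tau> A (i, j)"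
    "\<And>i. i \<in> {2..n} \<Longrightarrow> Z (n + 1, i) = relabel ?\<tau> A (1, i)"
    "sym_part (Z (1, n + 1)) \<in> (\<lambda>i. sym_part (relabel ?\<tau> A (1, i))) ` {2..n}"
    using duplication_first[OF _ n] by blast
  have \<tau>: "?\<tau> i \<in> {1..n}" if "i \<in> {1..n}" for i
    using that p n by (auto simp: Transposition.transpose_def)
  have \<tau>p: "?\<tau> i \<in> {2..n}" if "i \<in> {1..n} - {p}" for i
    using that p n by (auto simp: Transposition.transpose_def)
  have \<tau>1: "?\<tau> i \<in> {1..n} - {p}" if "i \<in> {2..n}" for i
    using that p n by (auto simp: Transposition.transpose_def)
  have \<tau>n: "?\<tau> (n + 1) = n + 1" using p n by (auto simp: Transposition.transpose_def)
  show ?thesis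
  proof (rule that[of "relabel ?\<tau> Z"])
    show "relabel ?\<tau> Z \<in> array_support \<nu>" using support_swap[OF Z(1), of 1 p] p by simp
    show "relabel ?\<tau> Z (i, j) = A (i, j)" if "i \<in> {1..n}" "j \<in> {1..n}" for i j
      using Z(2)[OF \<tau>[OF that(1)] \<tau>[OF that(2)]] by simp
    show "relabel ?\<tau> Z (n + 1, i) = A (p, i)" if "i \<in> {1..n} - {p}" for i
      using Z(3)[OF \<tau>p[OF that]] \<tau>n by simp
    show "sym_part (relabel ?\<tau> Z (p, n + 1)) \<in> (\<lambda>i. sym_part (A (p, i))) ` ({1..n} - {p})"
      using Z(4) \<tau>n \<tau>1 by auto
  qed
qed

section \<open>Repeated duplication and positivity of Gram forms\<close>

text \<open>\<open>g i\<close> is the replica of which replica \<open>i\<close> is a duplicate.\<close>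

lemma blow_up:
  assumes A: "A \<in> array_support \<nu>" and n: "2 \<le> n"
    and g: "\<And>i. 1 \<le> i \<Longrightarrow> g i \<in> {1..n}" "\<And>i. i \<in> {1..n} \<Longrightarrow> g i = i"
    and m: "n \<le> m"
  shows "\<exists>R\<in>array_support \<nu>. \<forall>i\<in>{1..m}. \<forall>j\<in>{1..m}.
    (g i \<noteq> g j \<longrightarrow> R (i, j) = A (g i, g j)) \<and>
    (g i = g j \<longrightarrow> i \<noteq> j \<longrightarrow> sym_part (R (i, j)) \<in> (\<lambda>y. sym_part (A (g i, y))) ` ({1..n} - {g i}))"
  using m
proof (induction m rule: nat_induct_at_least)
  case base
  show ?case using A g(2) by (intro bexI[of _ A]) auto
next
  case (Suc m)
  let ?K = "\<lambda>x. (\<lambda>y. sym_part (A (x, y))) ` ({1..n} - {x})"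
  from Suc obtain R where R: "R \<in> array_support \<nu>"
    "\<And>i j. i \<in> {1..m} \<Longrightarrow> j \<in> {1..m} \<Longrightarrow> g i \<noteq> g j \<Longrightarrow> R (i, j) = A (g i, g j)"
    "\<And>i j. i \<in> {1..m} \<Longrightarrow> j \<in> {1..m} \<Longrightarrow> g i = g j \<Longrightarrow> i \<noteq> j \<Longrightarrow> sym_part (R (i, j)) \<in> ?K (g i)"
    by blast
  \<comment> \<open>The new replica \<open>m + 1\<close> is made by duplicating its
    original.\<close>
  define p where "p = g (m + 1)"
  have p: "p \<in> {1..n}" "p \<in> {1..m}" "g p = p"
    using g(1)[of "m + 1"] g(2)[of p] Suc by (auto simp: p_def)
  have m: "2 \<le> m" using n Suc by simp
  from duplication[OF R(1) m p(2)] obtain Z where Z: "Z \<in> array_support \<nu>"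
    "\<And>i j. i \<in> {1..m} \<Longrightarrow> j \<in> {1..m} \<Longrightarrow> Z (i, j) = R (i, j)"
    "\<And>i. i \<in> {1..m} - {p} \<Longrightarrow> Z (m + 1, i) = R (p, i)"
    "sym_part (Z (p, m + 1)) \<in> (\<lambda>i. sym_part (R (p, i))) ` ({1..m} - {p})"
    by blast
  \<comment> \<open>All overlaps of \<open>p\<close> with other replicas, earlier duplicates
    included, have admissible symmetric parts; hence so does the overlap with the new twin.\<close>
  have Rp: "sym_part (R (p, i)) \<in> ?K p" if "i \<in> {1..m} - {p}" for i
  proof (cases "g i = p")
    case True
    then show ?thesis using R(3)[of p i] p that by auto
  next
    case False
    then show ?thesis using R(2)[of p i] p that g(1)[of i] by auto
  qed
  have Zsym: "sym_part (Z (j, i)) = sym_part (Z (i, j))" if "1 \<le> i" "1 \<le> j" for i j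
    using support_transpose[OF Z(1) that] by (simp add: sym_part_transpose)
  have new: "(p \<noteq> g i \<longrightarrow> Z (m + 1, i) = A (p, g i)) \<and> (p = g i \<longrightarrow> sym_part (Z (m + 1, i)) \<in> ?K p)"
    if i: "i \<in> {1..m}" for i
  proof (cases "i = p")
    case True
    then have "sym_part (Z (m + 1, i)) = sym_part (Z (p, m + 1))" using Zsym[of p "m + 1"] i by simp
    moreover obtain y where "y \<in> {1..m} - {p}" "sym_part (Z (p, m + 1)) = sym_part (R (p, y))"
      using Z(4) by blast
    ultimately show ?thesis using Rp[of y] p True by simp
  next
    case False
    then show ?thesis using Z(3)[of i] i Rp[of i] R(2)[of p i] p by auto
  qed
  have new': "(g i \<noteq> p \<longrightarrow> Z (i, m + 1) = A (g i, p)) \<and> (g i = p \<longrightarrow> sym_part (Z (i, m + 1)) \<in> ?K p)"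
    if i: "i \<in> {1..m}" for i
    using new[OF i] Zsym[of i "m + 1"] support_transpose[OF Z(1), of "m + 1" i]
      support_transpose[OF A, of p "g i"] i p g(1)[of i] by auto
  show ?case
  proof (intro bexI[OF _ Z(1)] ballI)
    fix i j assume "i \<in> {1..Suc m}" "j \<in> {1..Suc m}"
    then consider "i \<in> {1..m}" "j \<in> {1..m}" | "i = m + 1" "j \<in> {1..m}" | "i \<in> {1..m}" "j = m + 1"
      | "i = m + 1" "j = m + 1"
      by force
    then show "(g i \<noteq> g j \<longrightarrow> Z (i, j) = A (g i, g j)) \<and>
      (g i = g j \<longrightarrow> i \<noteq> j \<longrightarrow> sym_part (Z (i, j)) \<in> ?K (g i))"
    proof cases
      case 1
      then show ?thesis using Z(2) R(2,3) by auto
    next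
      case 2
      then show ?thesis using new[of j] by (auto simp: p_def)
    next
      case 3
      then show ?thesis using new'[of i] by (auto simp: p_def)
    qed simp
  qed
qed

text \<open>Replicas 1 and 2 are blown up to \<open>M\<close> copies each, carrying the vectors
  \<open>u\<close> and \<open>w\<close>. Only one overlap value is there to be repeated, so inside a
  group all overlaps have the symmetric part of \<open>A (1, 2)\<close>. The Gram form is M^2 times
  the claimed expression plus a term of order \<open>M\<close>.\<close>

lemma support_quadratic_nonneg:
  assumes A: "A \<in> array_support \<nu>"
  shows "0 \<le> u \<bullet> (A (1, 2) *v u) + w \<bullet> (A (1, 2) *v w) + 2 * (u \<bullet> (A (1, 2) *v w))"
proof -
  let ?X = "A (1, 2)"
  define g :: "nat \<Rightarrow> nat" where "g i = (if odd i then 1 else 2)" for i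
  define x where "x i = (if odd i then u else w)" for i :: nat
  \<comment> \<open>The correction on the diagonal, where the overlap is \<open>D\<close> and not
    \<open>?X\<close>.\<close>
  define e where "e i = x i \<bullet> (D *v x i) - x i \<bullet> (?X *v x i)" for i
  have A21: "A (2, 1) = transpose ?X" using support_transpose[OF A, of 1 2] by simp
  have quad21: "w \<bullet> (A (2, 1) *v u) = u \<bullet> (?X *v w)"
    unfolding A21 by (rule inner_transpose_matrix)
  have main: "0 \<le> (u \<bullet> (?X *v u) + w \<bullet> (?X *v w) + 2 * (u \<bullet> (?X *v w))) * real M + (e 1 + e 2)"
    if M: "1 \<le> M" for M
  proof -
    have "i = 1 \<or> i = 2" if "i \<in> {1..2}" for i :: nat
      using that by auto
    then have g: "g i \<in> {1..2}" "i \<in> {1..2} \<Longrightarrow> g i = i" for i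
      by (force simp: g_def)+
    have "2 \<le> 2 * M" using M by simp
    from blow_up[OF A order_refl g this] obtain R where R: "R \<in> array_support \<nu>"
      "\<And>i j. i \<in> {1..2 * M} \<Longrightarrow> j \<in> {1..2 * M} \<Longrightarrow> g i \<noteq> g j \<Longrightarrow> R (i, j) = A (g i, g j)"
      "\<And>i j. i \<in> {1..2 * M} \<Longrightarrow> j \<in> {1..2 * M} \<Longrightarrow> g i = g j \<Longrightarrow> i \<noteq> j \<Longrightarrow>
         sym_part (R (i, j)) \<in> (\<lambda>y. sym_part (A (g i, y))) ` ({1..2} - {g i})"
      by blast
    have K: "(\<lambda>y. sym_part (A (g i, y))) ` ({1..2} - {g i}) = {sym_part ?X}" for i
    proof -
      have "{1..2} = {1, 2 :: nat}" by auto
      then have "{1..2} - {g i} = {3 - g i}" by (auto simp: g_def)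
      then show ?thesis by (simp add: g_def A21[unfolded One_nat_def] sym_part_transpose)
    qed
    define s where "s i j = (if odd i then if odd j then u \<bullet> (?X *v u) else u \<bullet> (?X *v w)
      else if odd j then u \<bullet> (?X *v w) else w \<bullet> (?X *v w))" for i j :: nat
    have entry: "x i \<bullet> (R (i, j) *v x j) = s i j + (if i = j then e i else 0)"
      if ij: "i \<in> {1..2 * M}" "j \<in> {1..2 * M}" for i j
    proof (cases "g i = g j")
      case True
      then have x: "x i = x j" "odd i \<longleftrightarrow> odd j" by (auto simp: g_def x_def split: if_splits)
      have "x i \<bullet> (R (i, j) *v x j) = (if i = j then x i \<bullet> (D *v x i) else x i \<bullet> (?X *v x i))"
      proof (cases "i = j")
        case False
        then have "sym_part (R (i, j)) = sym_part ?X" using R(3)[OF ij True] K by auto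
        then show ?thesis using False x quad_sym_part[of "x i"] by metis
      qed (use support_diag[OF R(1)] ij in auto)
      then show ?thesis using x by (auto simp: s_def e_def x_def)
    next
      case False
      then show ?thesis using R(2)[OF ij False]
        by (auto simp: g_def x_def s_def quad21[unfolded One_nat_def] split: if_splits)
    qed
    have s_sum: "(\<Sum>i\<in>{1..2 * M}. \<Sum>j\<in>{1..2 * M}. s i j)
      = real M * (real M * (u \<bullet> (?X *v u) + w \<bullet> (?X *v w) + 2 * (u \<bullet> (?X *v w))))"
    proof -
      have "(\<Sum>j\<in>{1..2 * M}. s i j) = (if odd i then real M * (u \<bullet> (?X *v u) + u \<bullet> (?X *v w))
        else real M * (u \<bullet> (?X *v w) + w \<bullet> (?X *v w)))" for i
        by (simp add: s_def sum_parity[unfolded One_nat_def])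
      then show ?thesis by (simp only: sum_parity) (simp add: algebra_simps)
    qed
    have "(\<Sum>i\<in>{1..2 * M}. e i) = (\<Sum>i\<in>{1..2 * M}. if odd i then e 1 else e 2)"
      by (intro sum.cong refl) (simp add: e_def x_def)
    then have e_sum: "(\<Sum>i\<in>{1..2 * M}. e i) = real M * (e 1 + e 2)"
      by (simp only: sum_parity)
    have "0 \<le> (\<Sum>i\<in>{1..2 * M}. \<Sum>j\<in>{1..2 * M}. x i \<bullet> (R (i, j) *v x j))"
      by (rule support_gram[OF R(1)])
    also have "\<dots> = (\<Sum>i\<in>{1..2 * M}. (\<Sum>j\<in>{1..2 * M}. s i j) + e i)"
      using entry by (intro sum.cong refl) (simp add: sum.distrib)
    also have "\<dots> = real M * ((u \<bullet> (?X *v u) + w \<bullet> (?X *v w) + 2 * (u \<bullet> (?X *v w))) * real M + (e 1 + e 2))"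
      unfolding sum.distrib s_sum e_sum by (simp add: algebra_simps)
    finally show ?thesis using M by (simp add: zero_le_mult_iff)
  qed
  \<comment> \<open>\<open>main\<close> requires \<open>M \<ge> 1\<close>, hence the shift to
    \<open>Suc M\<close>.\<close>
  have "0 \<le> (u \<bullet> (?X *v u) + w \<bullet> (?X *v w) + 2 * (u \<bullet> (?X *v w))) * real M
      + ((u \<bullet> (?X *v u) + w \<bullet> (?X *v w) + 2 * (u \<bullet> (?X *v w))) + (e 1 + e 2))" for M
    using main[of "Suc M"] by (simp add: algebra_simps)
  then show ?thesis by (rule slope_nonneg_of_linear_bound)
qed

section \<open>Positivity, ultrametricity and synchronization\<close>

text \<open>For the second vector \<open>e *\<^sub>R z - u\<close> all terms quadratic in
  \<open>u\<close> cancel. What remains is \<open>e * a + e * e * b\<close> with the defect of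
  symmetry \<open>a\<close>, and this is negative for small \<open>e\<close> of the opposite
  sign.\<close>

lemma support_pair_psd:
  assumes A: "A \<in> array_support \<nu>" shows "A (1, 2) \<in> psd"
proof -
  let ?X = "A (1, 2)"
  have pos: "0 \<le> x \<bullet> (?X *v x)" for x
    using support_quadratic_nonneg[OF A, of x 0] by simp
  have sym: "u \<bullet> (?X *v z) = z \<bullet> (?X *v u)" for u z
  proof (rule ccontr)
    assume "u \<bullet> (?X *v z) \<noteq> z \<bullet> (?X *v u)"
    define a where "a = u \<bullet> (?X *v z) - z \<bullet> (?X *v u)"
    define b where "b = z \<bullet> (?X *v z)"
    \<comment> \<open>The denominator \<open>b + 1\<close> is positive even if \<open>b = 0\<close>,
      and it turns the expression into minus a square.\<close>
    define e where "e = - a / (b + 1)"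
    have b: "0 < b + 1" using pos[of z] by (simp add: b_def)
    have "0 \<le> u \<bullet> (?X *v u) + (e *\<^sub>R z - u) \<bullet> (?X *v (e *\<^sub>R z - u)) + 2 * (u \<bullet> (?X *v (e *\<^sub>R z - u)))"
      by (rule support_quadratic_nonneg[OF A])
    also have "\<dots> = e * a + e * e * b"
      by (simp add: a_def b_def matrix_vector_mult_diff_distrib matrix_vector_mult_scaleR
          inner_diff_left inner_diff_right algebra_simps)
    also have "\<dots> = - (a / (b + 1))\<^sup>2"
      using b unfolding e_def by (simp add: power2_eq_square divide_simps) (simp add: algebra_simps)
    finally have "a / (b + 1) = 0" by simp
    then show False using b \<open>u \<bullet> (?X *v z) \<noteq> z \<bullet> (?X *v u)\<close> by (simp add: a_def)
  qed
  have "?X $ k $ k' = ?X $ k' $ k" for k k'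
    using sym[of "axis k 1" "axis k' 1"] by (simp only: inner_axis_matrix)
  then show ?thesis using pos by (simp add: psd_iff)
qed

section \<open>Ultrametricity of quadratic forms\<close>

text \<open>Replicas \<open>2\<close> and \<open>3\<close> are duplicated \<open>M\<close> times each. All overlaps within the two groups are then at most
  \<open>c\<close>, so the averages of the groups nearly coincide, which contradicts \<open>a < b\<close>.\<close>

lemma support_ultrametric_aux:
  fixes v w :: "real ^ 'k"
  assumes A: "A \<in> array_support \<nu>"
  defines "q \<equiv> \<lambda>X. v \<bullet> (X *v v) + w \<bullet> (X *v w)"
  assumes ab: "q (A (1, 2)) < q (A (1, 3))" and bc: "q (A (1, 3)) \<le> q (A (2, 3))"
  shows False
proof -
  define a b c d where "a = q (A (1, 2))" and "b = q (A (1, 3))" and "c = q (A (2, 3))" and "d = q D"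
  have q_sym: "q (sym_part X) = q X" for X by (simp add: q_def quad_sym_part)
  have q_swap: "q (A (j, i)) = q (A (i, j))" if "1 \<le> i" "1 \<le> j" for i j
    using support_transpose[OF A that] q_sym[of "A (i, j)"] q_sym[of "A (j, i)"]
    by (simp add: sym_part_transpose)
  \<comment> \<open>Chosen so that \<open>t * (b - a) + (d - c) = -1\<close>, which gives the total
    the slope -2 in \<open>M\<close>.\<close>
  define t where "t = - (d - c + 1) / (b - a)"
  define g :: "nat \<Rightarrow> nat" where "g i = (if i = 1 then 1 else if even i then 2 else 3)" for i
  \<comment> \<open>Opposite signs on the copies of 2 and 3 cancel the terms of order M^2; replica 1
    with weight \<open>t\<close> tests the difference of the two averages.\<close>
  define y where "y i = (if i = 1 then t else if even i then -1 else 1)" for i :: nat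
  \<comment> \<open>\<open>s\<close> bounds the overlaps and \<open>e\<close> corrects the diagonal.
    The self-overlap of replica 1 is contained entirely in \<open>e 1\<close>, whence
    \<open>s 1 1 = 0\<close>.\<close>
  define s where "s i j = (if i = 1 then if j = 1 then 0 else if even j then a else b
    else if even i then if j = 1 then a else c else if j = 1 then b else c)" for i j :: nat
  define e where "e i = (if i = 1 then t * t * d else if even i then d - c else d - c)" for i :: nat
  have "0 \<le> (-2) * real M + (t * t * d - 2)" for M
  proof -
    let ?m = "2 * Suc M + 1"
    have "i = 1 \<or> i = 2 \<or> i = 3" if "i \<in> {1..3}" for i :: nat
      using that by auto
    then have g: "g i \<in> {1..3}" "i \<in> {1..3} \<Longrightarrow> g i = i" for i
      by (force simp: g_def)+
    have "2 \<le> (3 :: nat)" "3 \<le> ?m" by simp_all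
    from blow_up[OF A this(1) g this(2)] obtain R where R: "R \<in> array_support \<nu>"
      "\<And>i j. i \<in> {1..?m} \<Longrightarrow> j \<in> {1..?m} \<Longrightarrow> g i \<noteq> g j \<Longrightarrow> R (i, j) = A (g i, g j)"
      "\<And>i j. i \<in> {1..?m} \<Longrightarrow> j \<in> {1..?m} \<Longrightarrow> g i = g j \<Longrightarrow> i \<noteq> j \<Longrightarrow>
         sym_part (R (i, j)) \<in> (\<lambda>z. sym_part (A (g i, z))) ` ({1..3} - {g i})"
      by blast
    \<comment> \<open>Inside a group of copies \<open>y i * y j = 1\<close>, so an upper bound on
      the overlap suffices, and by \<open>ab\<close> and \<open>bc\<close> none exceeds
      \<open>c\<close>. Between groups equality holds.\<close>
    have bound: "y i * y j * q (R (i, j)) \<le> y i * y j * s i j + (if i = j then e i else 0)"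
      if ij: "i \<in> {1..?m}" "j \<in> {1..?m}" for i j
    proof (cases "g i = g j")
      case True
      then have same: "(i = 1 \<longleftrightarrow> j = 1) \<and> (i \<noteq> 1 \<longrightarrow> (even i \<longleftrightarrow> even j))"
        by (cases "i = 1"; cases "j = 1"; cases "even i"; cases "even j") (simp_all add: g_def)
      show ?thesis
      proof (cases "i = j")
        case True
        then have "q (R (i, j)) = d" using support_diag[OF R(1), of i] ij by (simp add: d_def)
        then show ?thesis using True by (auto simp: y_def s_def e_def)
      next
        case False
        then have i: "i \<noteq> 1" "j \<noteq> 1" using same by auto
        obtain z where z: "z \<in> {1..3} - {g i}" "sym_part (R (i, j)) = sym_part (A (g i, z))"
          using R(3)[OF ij True False] by blast
        have "q (R (i, j)) = q (A (g i, z))" using q_sym[of "R (i, j)"] q_sym[of "A (g i, z)"] z by simp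
        also have "\<dots> \<le> c"
        proof -
          have "z = 1 \<or> z = 2 \<or> z = 3" using z by auto
          then show ?thesis using z i ab bc q_swap[of 1 2] q_swap[of 1 3] q_swap[of 2 3]
            unfolding g_def by (auto simp: c_def)
        qed
        finally show ?thesis using same i False by (auto simp: y_def s_def)
      qed
    next
      case False
      then have "q (R (i, j)) = q (A (g i, g j))" using R(2)[OF ij] by simp
      also have "\<dots> = s i j"
        using False q_swap[of 1 2] q_swap[of 1 3] q_swap[of 2 3]
        by (auto simp: g_def s_def a_def b_def c_def split: if_splits)
      finally show ?thesis using False by auto
    qed
    have s_sum: "(\<Sum>i\<in>{1..?m}. \<Sum>j\<in>{1..?m}. y i * y j * s i j) = 2 * t * real (Suc M) * (b - a)"
    proof -
      have "(\<Sum>j\<in>{1..?m}. y i * y j * s i j) = (if i = 1 then t * (real (Suc M) * (b - a))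
        else if even i then - t * a else t * b)" for i
      proof -
        have "(\<Sum>j\<in>{1..?m}. y i * y j * s i j) = (\<Sum>j\<in>{1..?m}. if j = 1 then y i * t * s i 1
          else if even j then - y i * s i 2 else y i * s i 3)"
          by (intro sum.cong refl) (auto simp: y_def s_def)
        also have "\<dots> = y i * t * s i 1 + real (Suc M) * (- y i * s i 2 + y i * s i 3)"
          by (rule sum_parity_Suc)
        also have "\<dots> = (if i = 1 then t * (real (Suc M) * (b - a))
          else if even i then - t * a else t * b)"
          by (simp add: y_def s_def algebra_simps)
        finally show ?thesis .
      qed
      then have "(\<Sum>i\<in>{1..?m}. \<Sum>j\<in>{1..?m}. y i * y j * s i j) =
        t * (real (Suc M) * (b - a)) + real (Suc M) * (- t * a + t * b)"
        by (simp only: sum_parity_Suc)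
      then show ?thesis by (simp add: algebra_simps)
    qed
    have e_sum: "(\<Sum>i\<in>{1..?m}. e i) = t * t * d + real (Suc M) * ((d - c) + (d - c))"
      unfolding e_def by (rule sum_parity_Suc)
    have "0 \<le> (\<Sum>i\<in>{1..?m}. \<Sum>j\<in>{1..?m}. (y i *\<^sub>R v) \<bullet> (R (i, j) *v (y j *\<^sub>R v)))
      + (\<Sum>i\<in>{1..?m}. \<Sum>j\<in>{1..?m}. (y i *\<^sub>R w) \<bullet> (R (i, j) *v (y j *\<^sub>R w)))"
      by (intro add_nonneg_nonneg support_gram[OF R(1)])
    also have "\<dots> = (\<Sum>i\<in>{1..?m}. \<Sum>j\<in>{1..?m}. y i * y j * q (R (i, j)))"
      unfolding sum.distrib[symmetric]
      by (intro sum.cong refl) (simp add: q_def matrix_vector_mult_scaleR ring_distribs mult_ac)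
    also have "\<dots> \<le> (\<Sum>i\<in>{1..?m}. \<Sum>j\<in>{1..?m}. y i * y j * s i j + (if i = j then e i else 0))"
      by (intro sum_mono bound)
    also have "\<dots> = (\<Sum>i\<in>{1..?m}. (\<Sum>j\<in>{1..?m}. y i * y j * s i j) + e i)"
      by (intro sum.cong refl) (simp add: sum.distrib)
    also have "\<dots> = 2 * real (Suc M) * (t * (b - a) + (d - c)) + t * t * d"
      unfolding sum.distrib s_sum e_sum by (simp add: algebra_simps)
    also have "t * (b - a) = - (d - c + 1)"
      using ab by (simp add: t_def a_def b_def)
    finally show ?thesis by (simp add: algebra_simps)
  qed
  then have "0 \<le> (-2 :: real)" by (rule slope_nonneg_of_linear_bound)
  then show False by simp
qed

text \<open>\<open>support_ultrametric_aux\<close> fixes the order of the two larger overlaps; the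
  other order follows by exchanging replicas 1 and 2.\<close>

lemma support_ultrametric:
  fixes v w :: "real ^ 'k"
  assumes A: "A \<in> array_support \<nu>"
  defines "q \<equiv> \<lambda>X. v \<bullet> (X *v v) + w \<bullet> (X *v w)"
  shows "min (q (A (1, 3))) (q (A (2, 3))) \<le> q (A (1, 2))"
proof (rule ccontr)
  assume "\<not> ?thesis"
  then have less: "q (A (1, 2)) < q (A (1, 3))" "q (A (1, 2)) < q (A (2, 3))" by auto
  define A' where "A' = relabel (swap 1 2) A"
  have A': "A' \<in> array_support \<nu>" unfolding A'_def using support_swap[OF A] by simp
  have eqs: "A' (1, 2) = transpose (A (1, 2))" "A' (1, 3) = A (2, 3)" "A' (2, 3) = A (1, 3)"
    using support_transpose[OF A, of 1 2] by (simp_all add: A'_def Transposition.transpose_def)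
  have "q (A' (1, 2)) = q (A (1, 2))"
    unfolding eqs q_def by (simp only: inner_transpose_matrix)
  then have less': "q (A' (1, 2)) < q (A' (1, 3))" using less eqs by simp
  show False
  proof (cases "q (A (1, 3)) \<le> q (A (2, 3))")
    case True
    then show ?thesis using support_ultrametric_aux[OF A, of v w] less(1) by (simp add: q_def)
  next
    case False
    then show ?thesis using support_ultrametric_aux[OF A', of v w] less' eqs by (simp add: q_def)
  qed
qed

text \<open>The identity for \<open>n = 2\<close> contains with weight 1/2 a product of
  expectations, positive for bumps around the two given overlaps. Some triple thus realizes both
  approximately, and a limit of such triples does so exactly.\<close>

lemma support_pair_extension:
  assumes A: "A \<in> array_support \<nu>" and A': "A' \<in> array_support \<nu>"
  obtains L where "L \<in> array_support \<nu>" "L (1, 2) = A (1, 2)" "sym_part (L (1, 3)) = sym_part (A' (1, 2))"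
proof -
  have "\<exists>Z. Z \<in> array_support \<nu> \<and> dist (Z (1, 2)) (A (1, 2)) < \<epsilon> \<and>
    dist (sym_part (Z (1, 3))) (sym_part (A' (1, 2))) < \<epsilon>" if \<epsilon>: "0 < \<epsilon>" for \<epsilon>
  proof (rule ccontr)
    assume contra: "\<not> ?thesis"
    define f where "f R = bump \<epsilon> (R (1, 2)) (A (1, 2))" for R :: "'k overlap_array"
    define \<psi> where "\<psi> X = bump \<epsilon> X (sym_part (A' (1, 2)))" for X
    have f: "f \<in> borel_measurable borel" "\<And>R. 0 \<le> f R" "\<And>R. f R \<le> 1"
      and \<psi>: "\<psi> \<in> borel_measurable borel" "\<And>X. 0 \<le> \<psi> X" "\<And>X. \<psi> X \<le> 1"
      using \<epsilon> by (auto simp: f_def \<psi>_def bump_nonneg bump_le_1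
          intro!: borel_measurable_continuous_onI continuous_intros)
    have \<psi>R: "(\<lambda>R :: 'k overlap_array. \<psi> (sym_part (R x))) \<in> borel_measurable borel" for x
      using \<psi>(1) by (rule measurable_compose[rotated])
        (auto intro!: borel_measurable_continuous_onI continuous_intros)
    have "AE R in \<nu>. f R * \<psi> (sym_part (R (1, 3))) = 0"
      using AE_array_support
    proof eventually_elim
      case (elim R)
      then have "\<not> (0 < f R \<and> 0 < \<psi> (sym_part (R (1, 3))))"
        using contra \<epsilon> by (auto simp: f_def \<psi>_def bump_pos_iff)
      then show ?case using f(2)[of R] \<psi>(2)[of "sym_part (R (1, 3))"] by (auto simp: less_le)
    qed
    then have "(\<integral>R. f R * \<psi> (sym_part (R (1, 3))) \<partial>\<nu>) = 0"
      by (rule integral_eq_zero_AE)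
    moreover have "local_on 2 f" by (auto simp: local_on_def f_def block_def)
    ultimately have "0 = 1 / 2 * (\<integral>R. f R \<partial>\<nu>) * (\<integral>R. \<psi> (sym_part (R (1, 2))) \<partial>\<nu>) +
      1 / 2 * (\<integral>R. f R * \<psi> (sym_part (R (1, 2))) \<partial>\<nu>)"
      using GG[of 2 f 1 \<psi> 1] f \<psi> by (simp add: numeral_3_eq_3 eval_nat_numeral)
    moreover have "0 \<le> (\<integral>R. f R * \<psi> (sym_part (R (1, 2))) \<partial>\<nu>)"
      using f \<psi> by (intro integral_nonneg_AE) auto
    moreover have "0 < (\<integral>R. f R \<partial>\<nu>)"
    proof (rule integral_pos_support[OF f A \<epsilon>, of 2])
      show "0 < f R" if "R \<in> cylinder 2 \<epsilon> A" for R
        using that \<epsilon> by (simp add: f_def bump_pos_iff cylinder_def block_def)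
    qed
    moreover have "0 < (\<integral>R. \<psi> (sym_part (R (1, 2))) \<partial>\<nu>)"
    proof (rule integral_pos_support[OF \<psi>R _ _ A' \<epsilon>, of _ _ 2])
      show "0 < \<psi> (sym_part (R (1, 2)))" if "R \<in> cylinder 2 \<epsilon> A'" for R
        using that \<epsilon> le_less_trans[OF dist_sym_part_le, of "R (1, 2)" "A' (1, 2)" \<epsilon>]
        by (simp add: \<psi>_def bump_pos_iff cylinder_def block_def)
    qed (use \<psi> in auto)
    ultimately have "0 < 1 / 2 * (\<integral>R. f R \<partial>\<nu>) * (\<integral>R. \<psi> (sym_part (R (1, 2))) \<partial>\<nu>)"
      "0 = 1 / 2 * (\<integral>R. f R \<partial>\<nu>) * (\<integral>R. \<psi> (sym_part (R (1, 2))) \<partial>\<nu>) +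
      1 / 2 * (\<integral>R. f R * \<psi> (sym_part (R (1, 2))) \<partial>\<nu>)"
      "0 \<le> (\<integral>R. f R * \<psi> (sym_part (R (1, 2))) \<partial>\<nu>)" by simp_all
    then show False by linarith
  qed
  from this[of "inverse (real (Suc k))" for k] obtain Z where Z: "\<And>k. Z k \<in> array_support \<nu>"
    "\<And>k. dist (Z k (1, 2)) (A (1, 2)) < inverse (real (Suc k))"
    "\<And>k. dist (sym_part (Z k (1, 3))) (sym_part (A' (1, 2))) < inverse (real (Suc k))"
    by (metis inverse_positive_iff_positive of_nat_0_less_iff zero_less_Suc)
  obtain L r where L: "L \<in> array_support \<nu>" "strict_mono r"
    "\<And>i j. 1 \<le> i \<Longrightarrow> 1 \<le> j \<Longrightarrow> (\<lambda>k. Z (r k) (i, j)) \<longlonglongrightarrow> L (i, j)"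
    by (rule support_limit[where A = Z, OF Z(1) support_bounded[OF Z(1)]]) (assumption, assumption, rule that)
  show ?thesis
  proof (rule that[OF L(1)])
    show "L (1, 2) = A (1, 2)"
      using LIMSEQ_unique[OF L(3)[of 1 2]]
        LIMSEQ_subseq_LIMSEQ[OF LIMSEQ_dist_less_inverse[OF Z(2)] L(2)] by (simp add: o_def)
    have "(\<lambda>k. sym_part (Z (r k) (1, 3))) \<longlonglongrightarrow> sym_part (L (1, 3))"
      by (rule continuous_on_tendsto_compose[OF continuous_on_sym_part[OF continuous_on_id[of UNIV]]])
        (use L(3) in auto)
    then show "sym_part (L (1, 3)) = sym_part (A' (1, 2))"
      using LIMSEQ_unique LIMSEQ_subseq_LIMSEQ[OF LIMSEQ_dist_less_inverse[OF Z(3)] L(2)]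
      by (force simp: o_def)
  qed
qed

text \<open>Let \<open>v\<close> and \<open>w\<close> order \<open>?X\<close> and \<open>?Y\<close>
  in opposite ways. Ultrametricity for \<open>v\<close> alone and for \<open>w\<close> alone bounds
  the form of the third overlap \<open>?Z\<close> by the smaller of the two others. The sum of both
  forms is then strictly smaller at \<open>?Z\<close> than at \<open>?X\<close> and at
  \<open>?Y\<close>, against ultrametricity for the pair.\<close>

lemma support_pairs_comparable:
  assumes A: "A \<in> array_support \<nu>" and A': "A' \<in> array_support \<nu>"
  shows "A' (1, 2) - A (1, 2) \<in> psd \<or> A (1, 2) - A' (1, 2) \<in> psd"
proof (rule ccontr)
  let ?X = "A (1, 2)" and ?Y = "A' (1, 2)"
  assume contra: "\<not> ?thesis"
  have psd: "?X \<in> psd" "?Y \<in> psd" using A A' support_pair_psd by auto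
  obtain v where v: "v \<bullet> (?Y *v v) < v \<bullet> (?X *v v)"
    using contra psd by (auto simp: psd_iff matrix_vector_mult_diff_rdistrib inner_diff_right not_le)
  obtain w where w: "w \<bullet> (?X *v w) < w \<bullet> (?Y *v w)"
    using contra psd by (auto simp: psd_iff matrix_vector_mult_diff_rdistrib inner_diff_right not_le)
  obtain L where L: "L \<in> array_support \<nu>" "L (1, 2) = ?X" "sym_part (L (1, 3)) = sym_part ?Y"
    using support_pair_extension[OF A A'] by blast
  let ?Z = "L (2, 3)"
  have L13: "x \<bullet> (L (1, 3) *v x) = x \<bullet> (?Y *v x)" for x
    using L(3) quad_sym_part[of x] by metis
  \<comment> \<open>\<open>L2\<close> and \<open>L3\<close> bring the other two overlaps of the
    triple to position (1, 2), the last one transposed.\<close>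
  define L2 where "L2 = relabel (swap 2 3) L"
  define L3 where "L3 = relabel (swap 1 3) L"
  have L23: "L2 \<in> array_support \<nu>" "L3 \<in> array_support \<nu>"
    unfolding L2_def L3_def using support_swap[OF L(1)] by simp_all
  have tr: "x \<bullet> (L (j, i) *v x) = x \<bullet> (L (i, j) *v x)" if "1 \<le> i" "1 \<le> j" for i j x
    using support_transpose[OF L(1) that] inner_transpose_matrix by metis
  have ineq1: "min (q ?Y) (q ?Z) \<le> q ?X" and ineq2: "min (q ?X) (q ?Z) \<le> q ?Y"
    and ineq3: "min (q ?Y) (q ?X) \<le> q ?Z" if q: "q = (\<lambda>X. x \<bullet> (X *v x) + z \<bullet> (X *v z))" for q x z
  proof -
    show "min (q ?Y) (q ?Z) \<le> q ?X"
      using support_ultrametric[OF L(1), of x z] L(2) L13 by (simp add: q)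
    show "min (q ?X) (q ?Z) \<le> q ?Y"
      using support_ultrametric[OF L23(1), of x z] L(2) L13 tr[of 2 3]
      by (simp add: q L2_def Transposition.transpose_def)
    show "min (q ?Y) (q ?X) \<le> q ?Z"
      using support_ultrametric[OF L23(2), of x z] L(2) L13 tr[of 1 2] tr[of 2 3] tr[of 1 3]
      by (simp add: q L3_def Transposition.transpose_def)
  qed
  have "v \<bullet> (?Z *v v) \<le> v \<bullet> (?Y *v v)"
    using ineq2[OF refl, of v 0] v by (simp add: min_def split: if_splits)
  moreover have "w \<bullet> (?Z *v w) \<le> w \<bullet> (?X *v w)"
    using ineq1[OF refl, of w 0] w by (simp add: min_def split: if_splits)
  ultimately show False
    using ineq3[OF refl, of v w] v w by (simp add: min_def split: if_splits)
qed

text \<open>The Gram form of two replicas with vectors \<open>v\<close> and \<open>- v\<close> is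
  twice the form of \<open>D - A (1, 2)\<close>.\<close>

lemma support_pair_le_diag:
  assumes A: "A \<in> array_support \<nu>"
  shows "D - A (1, 2) \<in> psd" "D \<in> psd"
proof -
  have D: "A (1, 1) = D" "A (2, 2) = D" using support_diag[OF A] by auto
  have Dsym: "D $ k $ k' = D $ k' $ k" for k k'
    using support_transpose[OF A, of 1 1] D by (simp add: transpose_def vec_eq_iff)
  have psd: "A (1, 2) \<in> psd" "A (2, 1) = A (1, 2)"
    using support_pair_psd[OF A] support_transpose[OF A, of 1 2] by (auto simp: psd_def)
  have two: "{1..2} = {1, 2 :: nat}" by auto
  have "0 \<le> v \<bullet> ((D - A (1, 2)) *v v)" for v
    using support_gram[OF A, where n = 2 and x = "\<lambda>i. if i = 1 then v else - v"] D psd(2)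
    by (simp add: two[unfolded One_nat_def] matrix_vector_mult_diff_rdistrib inner_diff_right
        linear_neg[OF matrix_vector_mul_linear])
  then show "D - A (1, 2) \<in> psd" using psd(1) Dsym by (simp add: psd_iff)
  then show "D \<in> psd" using psd_add[OF _ psd(1)] by force
qed

text \<open>Two transpositions move an off-diagonal pair to position (1, 2).\<close>

lemma AE_entries:
  "AE R in \<nu>. \<forall>i\<ge>1. \<forall>j\<ge>1. R (i, j) = D \<or> (\<exists>A\<in>array_support \<nu>. R (i, j) = A (1, 2))"
  using AE_array_support
proof eventually_elim
  case (elim R)
  show ?case
  proof (intro allI impI)
    fix i j :: nat assume ij: "1 \<le> i" "1 \<le> j"
    show "R (i, j) = D \<or> (\<exists>A\<in>array_support \<nu>. R (i, j) = A (1, 2))"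
    proof (cases "i = j")
      case True
      then show ?thesis using support_diag[OF elim] ij by simp
    next
      case False
      \<comment> \<open>The position of replica \<open>j\<close> after the first
        transposition.\<close>
      define j' where "j' = swap 1 i j"
      define A where "A = relabel (swap 2 j') (relabel (swap 1 i) R)"
      have j': "2 \<le> j'" using False ij by (auto simp: j'_def Transposition.transpose_def)
      have "A \<in> array_support \<nu>"
        unfolding A_def using ij j' by (intro support_swap elim) auto
      moreover have "A (1, 2) = R (i, j)"
        using j' ij False by (auto simp: A_def j'_def Transposition.transpose_def split: if_splits)
      ultimately show ?thesis by metis
    qed
  qed
qed

text \<open>Positivity, boundedness and comparability pass to the closure of the set of overlap
  values, a compact chain to which \<open>psd_chain_extension\<close> applies;
  \<open>psd_norm1_le\<close> turns trace increments into norm increments.\<close>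

theorem synchronization:
  obtains \<Phi> where "\<And>x. 0 \<le> x \<Longrightarrow> \<Phi> x \<in> psd"
    "AE R in \<nu>. \<forall>i\<ge>1. \<forall>j\<ge>1. 0 \<le> trace (R (i, j)) \<and> R (i, j) = \<Phi> (trace (R (i, j)))"
    "\<And>x x'. 0 \<le> x \<Longrightarrow> x \<le> x' \<Longrightarrow> \<Phi> x' - \<Phi> x \<in> psd"
    "\<And>x x'. 0 \<le> x \<Longrightarrow> 0 \<le> x' \<Longrightarrow> norm1 (\<Phi> x' - \<Phi> x) \<le> real CARD('k) * \<bar>x' - x\<bar>"
proof -
  \<comment> \<open>\<open>D\<close> covers the diagonal of the array, and 0 starts the chain at
    trace 0.\<close>
  define W where "W = insert 0 (insert D ((\<lambda>A. A (1, 2)) ` array_support \<nu>))"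
  have "\<exists>A. A \<in> array_support \<nu>"
  proof (rule ccontr)
    assume "\<nexists>A. A \<in> array_support \<nu>"
    then have "AE R in \<nu>. False" using AE_array_support by simp
    then show False by simp
  qed
  then have D: "D \<in> psd" "norm D \<le> B"
    using support_pair_le_diag(2) support_diag[of _ 1] support_bounded[of _ 1 1] by force+
  have W_psd: "W \<subseteq> psd" using D support_pair_psd psd_0 by (auto simp: W_def)
  have W_chain: "Y - X \<in> psd \<or> X - Y \<in> psd" if "X \<in> W" "Y \<in> W" for X Y
    using that W_psd support_pairs_comparable support_pair_le_diag psd_0 by (auto simp: W_def)
  define V where "V = closure W"
  have "norm X \<le> B" if "X \<in> W" for X
    using that D(2) order_trans[OF norm_ge_zero D(2)] support_bounded[of _ 1 2] by (auto simp: W_def)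
  then have "bounded W" by (auto simp: bounded_iff)
  then have V_compact: "compact V" by (simp add: V_def)
  have V_psd: "V \<subseteq> psd"
    unfolding V_def by (rule closure_minimal[OF W_psd closed_psd])
  have V_chain: "Y - X \<in> psd \<or> X - Y \<in> psd" if XY: "X \<in> V" "Y \<in> V" for X Y
  proof -
    define S :: "((real ^ 'k ^ 'k) \<times> (real ^ 'k ^ 'k)) set"
      where "S = {(X, Y). Y - X \<in> psd \<or> X - Y \<in> psd}"
    have "S = (\<lambda>p. snd p - fst p) -` psd \<union> (\<lambda>p. fst p - snd p) -` psd" by (auto simp: S_def)
    also have "closed \<dots>"
      by (intro closed_Un continuous_closed_vimage closed_psd continuous_intros)
    finally have "closure (W \<times> W) \<subseteq> S"
      using W_chain by (intro closure_minimal) (auto simp: S_def)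
    then show ?thesis using XY by (auto simp: V_def closure_Times S_def)
  qed
  have WV: "W \<subseteq> V" unfolding V_def by (rule closure_subset)
  have "0 \<in> V" using WV by (auto simp: W_def)
  from psd_chain_extension[OF V_compact this V_psd V_chain]
  obtain \<Phi> where \<Phi>: "\<And>x. 0 \<le> x \<Longrightarrow> \<Phi> x \<in> psd" "\<And>A. A \<in> V \<Longrightarrow> \<Phi> (trace A) = A"
    "\<And>x x'. 0 \<le> x \<Longrightarrow> x \<le> x' \<Longrightarrow> \<Phi> x' - \<Phi> x \<in> psd"
    "\<And>x x'. 0 \<le> x \<Longrightarrow> x \<le> x' \<Longrightarrow> trace (\<Phi> x' - \<Phi> x) \<le> x' - x"
    by blast
  show ?thesis
  proof (rule that[OF \<Phi>(1) _ \<Phi>(3)])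
    show "AE R in \<nu>. \<forall>i\<ge>1. \<forall>j\<ge>1. 0 \<le> trace (R (i, j)) \<and> R (i, j) = \<Phi> (trace (R (i, j)))"
      using AE_entries
    proof eventually_elim
      case (elim R)
      then have "R (i, j) \<in> V" if "1 \<le> i" "1 \<le> j" for i j
        using that WV by (force simp: W_def)
      then show ?case using V_psd psd_trace_nonneg \<Phi>(2) by (metis subsetD)
    qed
    have Lip: "norm1 (\<Phi> x' - \<Phi> x) \<le> real CARD('k) * \<bar>x' - x\<bar>" if "0 \<le> x" "x \<le> x'" for x x'
    proof -
      have "norm1 (\<Phi> x' - \<Phi> x) \<le> real CARD('k) * trace (\<Phi> x' - \<Phi> x)"
        by (rule psd_norm1_le[OF \<Phi>(3)[OF that]])
      also have "\<dots> \<le> real CARD('k) * (x' - x)"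
        using \<Phi>(4)[OF that] by (intro mult_left_mono) auto
      finally show ?thesis using that by simp
    qed
    have "norm1 (X - Y) = norm1 (Y - X)" for X Y :: "real ^ 'k ^ 'k"
      by (simp add: norm1_def abs_minus_commute)
    then show "norm1 (\<Phi> x' - \<Phi> x) \<le> real CARD('k) * \<bar>x' - x\<bar>" if "0 \<le> x" "0 \<le> x'" for x x'
      using Lip[of x x'] Lip[of x' x] that by (metis abs_minus_commute linear)
  qed
qed

end

section \<open>Overlaps of configurations\<close>

lemma overlap_entry:
  "overlap N \<sigma> \<tau> $ k $ k' = 1 / real N * (\<Sum>i\<in>{1..N}. of_bool (\<sigma> i = k) * of_bool (\<tau> i = k'))"
  by (simp add: overlap_def)

lemma inner_overlap:
  fixes x y :: "real ^ 'k"
  shows "x \<bullet> (overlap N \<sigma> \<tau> *v y) = 1 / real N * (\<Sum>i\<in>{1..N}. x $ \<sigma> i * y $ \<tau> i)"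
proof -
  have "x $ \<sigma> i * y $ \<tau> i =
    (\<Sum>k\<in>UNIV. \<Sum>k'\<in>UNIV. x $ k * (of_bool (\<sigma> i = k) * of_bool (\<tau> i = k')) * y $ k')" for i
  proof -
    have "(\<Sum>k\<in>UNIV. \<Sum>k'\<in>UNIV. x $ k * (of_bool (\<sigma> i = k) * of_bool (\<tau> i = k')) * y $ k')
      = (\<Sum>k\<in>UNIV. x $ k * of_bool (\<sigma> i = k)) * (\<Sum>k'\<in>UNIV. of_bool (\<tau> i = k') * y $ k')"
      by (simp only: sum_product mult_ac)
    also have "(\<Sum>k\<in>UNIV. x $ k * of_bool (\<sigma> i = k)) = x $ \<sigma> i" by (simp add: of_bool_def if_distrib cong: if_cong)
    also have "(\<Sum>k'\<in>UNIV. of_bool (\<tau> i = k') * y $ k') = y $ \<tau> i"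
      by (simp add: of_bool_def if_distrib if_distribR cong: if_cong)
    finally show ?thesis by simp
  qed
  then have "(\<Sum>i\<in>{1..N}. x $ \<sigma> i * y $ \<tau> i) = (\<Sum>k\<in>UNIV. \<Sum>k'\<in>UNIV. \<Sum>i\<in>{1..N}.
      x $ k * (of_bool (\<sigma> i = k) * of_bool (\<tau> i = k')) * y $ k')"
    by (simp only: sum.swap[of _ UNIV "{1..N}"])
  then show ?thesis
    unfolding inner_matrix_vector_sum overlap_entry
    by (simp only: sum_distrib_left sum_distrib_right mult_ac)
qed

lemma overlap_transpose: "overlap N \<tau> \<sigma> = transpose (overlap N \<sigma> \<tau>)"
  by (simp add: overlap_def transpose_def vec_eq_iff mult.commute)

text \<open>The double sum is an average over sites of squares.\<close>

lemma overlap_gram: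
  fixes x :: "nat \<Rightarrow> real ^ 'k"
  shows "0 \<le> (\<Sum>i\<in>{1..n}. \<Sum>j\<in>{1..n}. x i \<bullet> (overlap N (s i) (s j) *v x j))"
proof -
  have "(\<Sum>i\<in>{1..n}. \<Sum>j\<in>{1..n}. x i \<bullet> (overlap N (s i) (s j) *v x j)) =
    1 / real N * (\<Sum>i\<in>{1..n}. \<Sum>j\<in>{1..n}. \<Sum>e\<in>{1..N}. x i $ s i e * x j $ s j e)"
    by (simp add: inner_overlap sum_distrib_left)
  also have "(\<Sum>i\<in>{1..n}. \<Sum>j\<in>{1..n}. \<Sum>e\<in>{1..N}. x i $ s i e * x j $ s j e) =
    (\<Sum>e\<in>{1..N}. (\<Sum>i\<in>{1..n}. x i $ s i e) * (\<Sum>j\<in>{1..n}. x j $ s j e))"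
    by (simp only: sum_product sum.swap[of _ "{1..N}" "{1..n}"])
  also have "0 \<le> 1 / real N * \<dots>"
    by (rule mult_nonneg_nonneg) (auto intro!: sum_nonneg zero_le_square)
  finally show ?thesis .
qed

text \<open>For \<open>N > 0\<close> the self-overlap is the diagonal matrix with entries
  \<open>d\<close>; here the constraint on the configurations enters.\<close>

lemma overlap_self_eq:
  assumes "\<sigma> \<in> configs N d" "\<tau> \<in> configs N d"
  shows "overlap N \<sigma> \<sigma> = overlap N \<tau> \<tau>"
proof -
  have "overlap N \<sigma> \<sigma> $ k $ k' = (if k = k' then 1 / real N * (real N * d $ k) else 0)"
    if "\<sigma> \<in> configs N d" for \<sigma> k k'
  proof -
    have "(\<Sum>i\<in>{1..N}. of_bool (\<sigma> i = k) * of_bool (\<sigma> i = k')) =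
      (if k = k' then (\<Sum>i\<in>{1..N}. of_bool (\<sigma> i = k)) else 0 :: real)"
      by (auto intro!: sum.neutral sum.cong)
    also have "(\<Sum>i\<in>{1..N}. of_bool (\<sigma> i = k)) = real N * d $ k"
      using that by (simp add: configs_def)
    finally show ?thesis by (simp add: overlap_entry)
  qed
  then show ?thesis using assms by (simp add: vec_eq_iff)
qed

lemma norm_overlap_le:
  "norm (overlap N \<sigma> \<tau> :: real ^ 'k ^ 'k) \<le> real CARD('k) * real CARD('k)"
proof -
  have entry: "\<bar>overlap N \<sigma> \<tau> $ k $ k'\<bar> \<le> 1" for k k' :: 'k
  proof -
    have "(\<Sum>i\<in>{1..N}. of_bool (\<sigma> i = k) * of_bool (\<tau> i = k')) \<le> (\<Sum>i\<in>{1..N}. 1 :: real)"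
      by (intro sum_mono) auto
    moreover have "0 \<le> (\<Sum>i\<in>{1..N}. of_bool (\<sigma> i = k) * of_bool (\<tau> i = k') :: real)"
      by (intro sum_nonneg) auto
    ultimately show ?thesis by (cases "N = 0") (auto simp: overlap_entry divide_le_eq)
  qed
  have "norm (overlap N \<sigma> \<tau>) \<le> (\<Sum>k\<in>UNIV. norm (overlap N \<sigma> \<tau> $ k))"
    unfolding norm_vec_def by (rule L2_set_le_sum) simp
  also have "\<dots> \<le> (\<Sum>k\<in>(UNIV :: 'k set). real CARD('k))"
  proof (rule sum_mono)
    fix k :: 'k
    have "norm (overlap N \<sigma> \<tau> $ k) \<le> (\<Sum>k'\<in>UNIV. \<bar>overlap N \<sigma> \<tau> $ k $ k'\<bar>)"
      by (rule norm_le_l1_cart)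
    also have "\<dots> \<le> (\<Sum>k'\<in>(UNIV :: 'k set). 1)" by (intro sum_mono entry)
    finally show "norm (overlap N \<sigma> \<tau> $ k) \<le> real CARD('k)" by simp
  qed
  finally show ?thesis by simp
qed

section \<open>Gibbs averages at finite size\<close>

lemma gibbs_weight_nonneg: "0 \<le> gibbs_weight j0 a u g N d \<sigma>"
  by (simp add: gibbs_weight_def sum_nonneg)

text \<open>The weights are nonnegative, so an \<open>F\<close> without positive values gives a
  nonpositive integrand. The Bochner integral keeps this sign even without integrability.\<close>

lemma replica_expectation_pos:
  assumes "0 < replica_expectation j0 a u N d n F"
  shows "\<exists>s\<in>{1..n} \<rightarrow>\<^sub>E configs N d. 0 < F (\<lambda>(l, l')\<in>block n. overlap N (s l) (s l'))"
proof (rule ccontr)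
  assume "\<not> ?thesis"
  then have F: "F (\<lambda>(l, l')\<in>block n. overlap N (s l) (s l')) \<le> 0"
    if "s \<in> {1..n} \<rightarrow>\<^sub>E configs N d" for s
    using that by (simp add: not_less)
  have "0 \<le> (\<integral>g. - (\<Sum>s\<in>{1..n} \<rightarrow>\<^sub>E configs N d. (\<Prod>l\<in>{1..n}. gibbs_weight j0 a u g N d (s l)) *
      F (\<lambda>(l, l')\<in>block n. overlap N (s l) (s l'))) \<partial>disorder)"
    by (intro integral_nonneg_AE AE_I2)
      (use F in \<open>auto intro!: sum_nonpos mult_nonneg_nonpos prod_nonneg gibbs_weight_nonneg\<close>)
  then show False using assms by (simp add: replica_expectation_def)
qed

text \<open>Given the disorder the replicas are independent and identically distributed: permuting a
  tuple leaves the product of its weights unchanged.\<close>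

lemma replica_expectation_relabel:
  assumes F: "local_on n F" and pq: "p \<in> {1..n}" "q \<in> {1..n}"
  shows "replica_expectation j0 a u N d n (\<lambda>R. F (relabel (swap p q) R)) = replica_expectation j0 a u N d n F"
proof -
  let ?\<tau> = "swap p q" and ?P = "{1..n} \<rightarrow>\<^sub>E configs N d"
  let ?w = "\<lambda>g s. \<Prod>l\<in>{1..n}. gibbs_weight j0 a u g N d (s l)"
  let ?A = "\<lambda>s. (\<lambda>(l, l')\<in>block n. overlap N (s l) (s l'))"
  have \<tau>: "?\<tau> l \<in> {1..n} \<longleftrightarrow> l \<in> {1..n}" for l
    using pq by (auto simp: Transposition.transpose_def)
  have bij: "bij_betw (\<lambda>s. s \<circ> ?\<tau>) ?P ?P"
  proof (rule bij_betw_byWitness[where f' = "\<lambda>s. s \<circ> ?\<tau>"])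
    have "s \<circ> ?\<tau> \<in> ?P" if "s \<in> ?P" for s
    proof (rule PiE_I)
      show "(s \<circ> ?\<tau>) l \<in> configs N d" if "l \<in> {1..n}" for l
        using PiE_mem[OF \<open>s \<in> ?P\<close>] \<tau> that by simp
      show "(s \<circ> ?\<tau>) l = undefined" if "l \<notin> {1..n}" for l
      proof -
        have "?\<tau> l \<notin> {1..n}" using \<tau> that by blast
        then show ?thesis using PiE_arb[OF \<open>s \<in> ?P\<close>] by (simp only: o_apply)
      qed
    qed
    then show "(\<lambda>s. s \<circ> ?\<tau>) ` ?P \<subseteq> ?P" "(\<lambda>s. s \<circ> ?\<tau>) ` ?P \<subseteq> ?P" by blast+
  qed (simp_all add: comp_assoc)
  have bij_\<tau>: "bij_betw ?\<tau> {1..n} {1..n}"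
    using permutes_imp_bij[OF permutes_swap_id[OF pq]] .
  have weight: "?w g (s \<circ> ?\<tau>) = ?w g s" for g s
    using prod.reindex_bij_betw[OF bij_\<tau>, of "\<lambda>l. gibbs_weight j0 a u g N d (s l)"] by simp
  have array: "F (relabel ?\<tau> (?A s)) = F (?A (s \<circ> ?\<tau>))" for s
  proof (rule F[unfolded local_on_def, rule_format])
    fix x assume x: "x \<in> block n"
    obtain l l' where l: "x = (l, l')" by (cases x)
    have "?\<tau> l \<in> {1..n}" "?\<tau> l' \<in> {1..n}" using x unfolding \<tau> by (simp_all add: l block_def)
    then have "(?\<tau> l, ?\<tau> l') \<in> block n" by (simp add: block_def)
    then show "relabel ?\<tau> (?A s) x = ?A (s \<circ> ?\<tau>) x"
      using x by (simp add: l)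
  qed
  have "(\<Sum>s\<in>?P. ?w g s * F (relabel ?\<tau> (?A s))) = (\<Sum>s\<in>?P. ?w g s * F (?A s))" for g
    using sum.reindex_bij_betw[OF bij, of "\<lambda>s. ?w g s * F (?A s)"] by (simp only: weight array)
  then show ?thesis by (simp add: replica_expectation_def)
qed

section \<open>The limiting law\<close>

text \<open>The passage from the product over \<open>I\<close> to the full function space;
  coordinates outside \<open>I\<close> are constantly \<open>undefined\<close>.\<close>

lemma measurable_PiM_ident:
  "(\<lambda>R. R) \<in> borel_measurable (\<Pi>\<^sub>M x\<in>(I :: 'i::countable set). (borel :: 'a::second_countable_topology measure))"
proof (rule measurable_coordinatewise_then_product)
  fix i
  show "(\<lambda>R. R i) \<in> borel_measurable (\<Pi>\<^sub>M x\<in>I. (borel :: 'a measure))"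
  proof (cases "i \<in> I")
    case False
    then have "R i = undefined" if "R \<in> space (\<Pi>\<^sub>M x\<in>I. (borel :: 'a measure))" for R
      using that by (auto simp: space_PiM PiE_def extensional_def)
    then show ?thesis by (subst measurable_cong[where g = "\<lambda>_. undefined"]) auto
  qed simp
qed

text \<open>The same passage for topologies, which makes continuous functions of the full array
  admissible in the definition of the limit.\<close>

lemma continuous_map_block:
  fixes F :: "'k::finite overlap_array \<Rightarrow> real"
  assumes "continuous_on UNIV F"
  shows "continuous_map (product_topology (\<lambda>x. euclidean) (block n)) euclideanreal F"
proof -
  let ?T = "product_topology (\<lambda>x. euclidean :: (real ^ 'k ^ 'k) topology) (block n)"
  have "continuous_map ?T euclidean (\<lambda>R. R x)" for x
  proof (cases "x \<in> block n")
    case True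
    then show ?thesis by (rule continuous_map_product_projection)
  next
    case False
    then have "\<And>R. R \<in> topspace ?T \<Longrightarrow> undefined = R x"
      by (cases x) (auto simp: PiE_def extensional_def)
    moreover have "continuous_map ?T euclidean (\<lambda>R. undefined :: real ^ 'k ^ 'k)"
      by (rule continuous_map_const[THEN iffD2]) simp
    ultimately show ?thesis by (rule continuous_map_eq[rotated])
  qed
  then have "continuous_map ?T euclidean (\<lambda>R. R)"
    unfolding euclidean_product_topology[symmetric] continuous_map_componentwise_UNIV by blast
  from continuous_map_compose[OF this, of euclideanreal F] show ?thesis
    using assms by (simp add: o_def)
qed

locale limiting_array =
  fixes j0 :: "real ^ 'k::finite \<Rightarrow> nat" and a u d r and \<mu> :: "'k overlap_array measure"
  assumes limiting: "limiting_overlap_law j0 a u d r \<mu>" and GG_\<mu>: "multi_species_GG \<mu>"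
begin

text \<open>Transports \<open>\<mu>\<close> to the full function space, so that it becomes a
  \<open>random_array\<close>.\<close>

definition law :: "'k overlap_array measure" where
  "law = distr \<mu> borel (\<lambda>R. R)"

lemma ident_measurable: "(\<lambda>R. R) \<in> borel_measurable \<mu>"
proof -
  have "sets \<mu> = sets (\<Pi>\<^sub>M x\<in>{1..} \<times> {1..}. borel)"
    using limiting by (simp add: limiting_overlap_law_def array_law_def)
  then show ?thesis using measurable_PiM_ident measurable_cong_sets by blast
qed

lemma integral_law: "f \<in> borel_measurable borel \<Longrightarrow> (\<integral>R. f R \<partial>law) = (\<integral>R. (f R :: real) \<partial>\<mu>)"
  unfolding law_def by (rule integral_distr[OF ident_measurable])

sublocale random_array law
proof -
  interpret \<mu>: prob_space \<mu>
    using limiting by (simp add: limiting_overlap_law_def array_law_def)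
  interpret prob_space law unfolding law_def by (rule \<mu>.prob_space_distr[OF ident_measurable])
  show "random_array law" by standard (simp add: law_def)
qed

abbreviation finite_expectation :: "nat \<Rightarrow> nat \<Rightarrow> ('k overlap_array \<Rightarrow> real) \<Rightarrow> real" where
  "finite_expectation i n F \<equiv> replica_expectation j0 a (u (r i)) (r i) (d (r i)) n F"

lemma local_restrict: "local_on n F \<Longrightarrow> F (restrict R (block n)) = F R"
  by (simp add: local_on_def)

lemma finite_expectation_tendsto:
  assumes "continuous_on UNIV F" "\<And>R. \<bar>F R\<bar> \<le> C" "local_on n F"
  shows "(\<lambda>i. finite_expectation i n F) \<longlonglongrightarrow> (\<integral>R. F R \<partial>law)"
proof -
  have "(\<lambda>i. finite_expectation i n F) \<longlonglongrightarrow> (\<integral>R. F (restrict R (block n)) \<partial>\<mu>)"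
    using limiting continuous_map_block[OF assms(1)] assms(2) unfolding limiting_overlap_law_def by blast
  then show ?thesis
    using assms by (simp add: local_restrict integral_law borel_measurable_continuous_onI)
qed

text \<open>Both sides are limits of the same sequence of finite-size expectations.\<close>

lemma law_exchangeable:
  fixes F :: "'k overlap_array \<Rightarrow> real"
  assumes F: "continuous_on UNIV F" "\<And>R. \<bar>F R\<bar> \<le> C" "local_on n F" and pq: "p \<in> {1..n}" "q \<in> {1..n}"
  shows "(\<integral>R. F (relabel (swap p q) R) \<partial>law) = (\<integral>R. F R \<partial>law)"
proof -
  let ?F = "\<lambda>R. F (relabel (swap p q) R)"
  have "continuous_on UNIV (relabel (swap p q) :: 'k overlap_array \<Rightarrow> _)"
    unfolding relabel_def case_prod_unfold by (intro continuous_intros)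
  then have "continuous_on UNIV ?F"
    by (rule continuous_on_compose2[OF F(1)]) simp
  moreover have "local_on n ?F"
    unfolding local_on_def
  proof (intro allI impI)
    fix R R' :: "'k overlap_array" assume R: "\<forall>x\<in>block n. R x = R' x"
    have "swap p q i \<in> {1..n}" if "i \<in> {1..n}" for i
      using that pq by (auto simp: Transposition.transpose_def)
    then have "\<forall>x\<in>block n. relabel (swap p q) R x = relabel (swap p q) R' x"
      using R by (auto simp: block_def)
    then show "?F R = ?F R'" using F(3) by (auto simp: local_on_def)
  qed
  ultimately have "(\<lambda>i. finite_expectation i n ?F) \<longlonglongrightarrow> (\<integral>R. ?F R \<partial>law)"
    using F(2) by (intro finite_expectation_tendsto) auto
  then have "(\<lambda>i. finite_expectation i n F) \<longlonglongrightarrow> (\<integral>R. ?F R \<partial>law)"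
    by (simp only: replica_expectation_relabel[OF F(3) pq])
  then show ?thesis using finite_expectation_tendsto[OF F(1-3)] LIMSEQ_unique by blast
qed

text \<open>A bump with positive integral under the limit has positive expectation at all late
  sizes, and this requires a tuple of configurations inside the cylinder.\<close>

lemma support_approx:
  assumes "A \<in> array_support law" "0 < \<epsilon>"
  shows "\<forall>\<^sub>F i in sequentially. \<exists>s\<in>{1..n} \<rightarrow>\<^sub>E configs (r i) (d (r i)).
    \<forall>l\<in>{1..n}. \<forall>l'\<in>{1..n}. dist (overlap (r i) (s l) (s l')) (A (l, l')) < \<epsilon>"
proof -
  have "(\<lambda>i. finite_expectation i n (cyl_bump n \<epsilon> A)) \<longlonglongrightarrow> (\<integral>R. cyl_bump n \<epsilon> A R \<partial>law)"
    using assms by (intro finite_expectation_tendsto[of _ 1])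
      (auto intro: continuous_on_cyl_bump local_on_cyl_bump simp: cyl_bump_nonneg cyl_bump_le_1)
  moreover have "0 < (\<integral>R. cyl_bump n \<epsilon> A R \<partial>law)" using assms support_cyl_bump by blast
  ultimately have "\<forall>\<^sub>F i in sequentially. 0 < finite_expectation i n (cyl_bump n \<epsilon> A)"
    by (rule order_tendstoD)
  then show ?thesis
  proof eventually_elim
    case (elim i)
    obtain s where s: "s \<in> {1..n} \<rightarrow>\<^sub>E configs (r i) (d (r i))"
      "0 < cyl_bump n \<epsilon> A (\<lambda>(l, l')\<in>block n. overlap (r i) (s l) (s l'))"
      using replica_expectation_pos[OF elim] by blast
    from s(2) show ?case
      using s(1) assms(2) by (intro bexI[of _ s]) (auto simp: cyl_bump_pos_iff cylinder_def block_def)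
  qed
qed

text \<open>Through this lemma, relations between overlaps that are stable under limits carry over
  to the support.\<close>

lemma support_limit_overlaps:
  assumes "A \<in> array_support law"
  obtains N s where "\<And>l l'. l \<in> {1..n} \<Longrightarrow> l' \<in> {1..n} \<Longrightarrow>
    (\<lambda>k. overlap (N k) (s k l) (s k l')) \<longlonglongrightarrow> A (l, l')"
proof -
  have "\<exists>N s. \<forall>l\<in>{1..n}. \<forall>l'\<in>{1..n}. dist (overlap N (s l) (s l')) (A (l, l')) < inverse (real (Suc k))" for k
    using eventually_happens[OF support_approx[OF assms, of "inverse (real (Suc k))" n]] by auto
  then obtain N s where "\<And>k. \<forall>l\<in>{1..n}. \<forall>l'\<in>{1..n}.
      dist (overlap (N k) (s k l) (s k l')) (A (l, l')) < inverse (real (Suc k))"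
    by metis
  then show ?thesis by (intro that[of N s] LIMSEQ_dist_less_inverse) auto
qed

lemma law_support_transpose:
  assumes A: "A \<in> array_support law" and ij: "1 \<le> i" "1 \<le> j"
  shows "A (j, i) = transpose (A (i, j))"
proof -
  obtain N s where lim: "\<And>l l'. l \<in> {1..max i j} \<Longrightarrow> l' \<in> {1..max i j} \<Longrightarrow>
    (\<lambda>k. overlap (N k) (s k l) (s k l')) \<longlonglongrightarrow> A (l, l')"
    using support_limit_overlaps[OF A] by blast
  have "(\<lambda>k. transpose (overlap (N k) (s k i) (s k j))) \<longlonglongrightarrow> transpose (A (i, j))"
    unfolding transpose_def by (intro tendsto_intros lim) (use ij in auto)
  then show ?thesis
    using lim[of j i] ij LIMSEQ_unique by (simp flip: overlap_transpose) blast
qed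

lemma law_support_gram:
  assumes A: "A \<in> array_support law"
  shows "0 \<le> (\<Sum>i\<in>{1..n}. \<Sum>j\<in>{1..n}. x i \<bullet> (A (i, j) *v x j))"
proof -
  obtain N s where lim: "\<And>l l'. l \<in> {1..n} \<Longrightarrow> l' \<in> {1..n} \<Longrightarrow>
    (\<lambda>k. overlap (N k) (s k l) (s k l')) \<longlonglongrightarrow> A (l, l')"
    using support_limit_overlaps[OF A] by blast
  have "(\<lambda>k. \<Sum>i\<in>{1..n}. \<Sum>j\<in>{1..n}. x i \<bullet> (overlap (N k) (s k i) (s k j) *v x j)) \<longlonglongrightarrow>
    (\<Sum>i\<in>{1..n}. \<Sum>j\<in>{1..n}. x i \<bullet> (A (i, j) *v x j))"
    unfolding inner_matrix_vector_sum by (intro tendsto_intros lim)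
  then show ?thesis by (rule LIMSEQ_le_const) (intro exI allI impI overlap_gram)
qed

lemma law_support_bounded:
  assumes A: "A \<in> array_support law" and ij: "1 \<le> i" "1 \<le> j"
  shows "norm (A (i, j)) \<le> real CARD('k) * real CARD('k)"
proof -
  obtain N s where lim: "\<And>l l'. l \<in> {1..max i j} \<Longrightarrow> l' \<in> {1..max i j} \<Longrightarrow>
    (\<lambda>k. overlap (N k) (s k l) (s k l')) \<longlonglongrightarrow> A (l, l')"
    using support_limit_overlaps[OF A] by blast
  have "(\<lambda>k. norm (overlap (N k) (s k i) (s k j))) \<longlonglongrightarrow> norm (A (i, j))"
    by (intro tendsto_norm lim) (use ij in auto)
  then show ?thesis by (rule LIMSEQ_le_const2) (use norm_overlap_le in auto)
qed

text \<open>Self-overlaps agree between configurations of equal size and proportions, so both arrays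
  are approximated at a common late index.\<close>

lemma law_support_diag_eq:
  assumes A: "A \<in> array_support law" "A' \<in> array_support law" and ij: "1 \<le> i" "1 \<le> j"
  shows "A (i, i) = A' (j, j)"
proof (rule ccontr)
  assume "A (i, i) \<noteq> A' (j, j)"
  define \<epsilon> where "\<epsilon> = dist (A (i, i)) (A' (j, j)) / 2"
  have \<epsilon>: "0 < \<epsilon>" using \<open>A (i, i) \<noteq> A' (j, j)\<close> by (simp add: \<epsilon>_def)
  obtain m s s' where s: "s \<in> {1..i} \<rightarrow>\<^sub>E configs (r m) (d (r m))" "s' \<in> {1..j} \<rightarrow>\<^sub>E configs (r m) (d (r m))"
    "\<forall>l\<in>{1..i}. \<forall>l'\<in>{1..i}. dist (overlap (r m) (s l) (s l')) (A (l, l')) < \<epsilon>"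
    "\<forall>l\<in>{1..j}. \<forall>l'\<in>{1..j}. dist (overlap (r m) (s' l) (s' l')) (A' (l, l')) < \<epsilon>"
    using eventually_happens[OF eventually_conj[OF support_approx[OF A(1) \<epsilon>, of i]
      support_approx[OF A(2) \<epsilon>, of j]]] by auto
  have "overlap (r m) (s i) (s i) = overlap (r m) (s' j) (s' j)"
    using s(1,2) ij by (intro overlap_self_eq[of _ _ "d (r m)"]) auto
  moreover have "dist (overlap (r m) (s i) (s i)) (A (i, i)) < \<epsilon>"
    "dist (overlap (r m) (s' j) (s' j)) (A' (j, j)) < \<epsilon>"
    using s(3,4) ij by auto
  ultimately have "dist (A (i, i)) (A' (j, j)) < \<epsilon> + \<epsilon>"
    by (metis add_strict_mono dist_commute dist_triangle le_less_trans)
  then show False by (simp add: \<epsilon>_def)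
qed

section \<open>Reduction of the identities to symmetric parts\<close>

text \<open>The symmetric part of a matrix is determined by its quadratic form, by polarization with the
  test vectors \<open>(e\<^sub>k \<plusminus> e\<^sub>k\<^sub>') / 2\<close>, whose entries lie in \<open>[-1, 1]\<close>.\<close>

lemma law_GG:
  fixes f :: "'k overlap_array \<Rightarrow> real" and \<psi> :: "real ^ 'k ^ 'k \<Rightarrow> real"
  assumes n: "2 \<le> n" and f: "f \<in> borel_measurable borel" "\<And>R. \<bar>f R\<bar> \<le> C" "local_on n f"
    and \<psi>: "\<psi> \<in> borel_measurable borel" "\<And>X. \<bar>\<psi> X\<bar> \<le> C'"
  shows "(\<integral>R. f R * \<psi> (sym_part (R (1, n + 1))) \<partial>law) =
        1 / real n * (\<integral>R. f R \<partial>law) * (\<integral>R. \<psi> (sym_part (R (1, 2))) \<partial>law) +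
        1 / real n * (\<Sum>l\<in>{2..n}. \<integral>R. f R * \<psi> (sym_part (R (1, l))) \<partial>law)"
proof -
  \<comment> \<open>One quadratic form for each pair of colours and each sign; \<open>e\<close>
    numbers them.\<close>
  define m where "m = CARD('k \<times> 'k \<times> bool)"
  obtain e :: "nat \<Rightarrow> 'k \<times> 'k \<times> bool" where e: "bij_betw e {1..m} UNIV"
    using ex_bij_betw_nat_finite_1[of "UNIV :: ('k \<times> 'k \<times> bool) set"] by (auto simp: m_def)
  define t :: "'k \<times> 'k \<times> bool \<Rightarrow> real ^ 'k"
    where "t = (\<lambda>(k, k', b). (1 / 2) *\<^sub>R (if b then axis k 1 + axis k' 1 else axis k 1 - axis k' 1))"
  define idx where "idx = inv_into {1..m} e"
  have idx: "idx z \<in> {1..m}" "e (idx z) = z" for z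
    using e inv_into_into[of z e "{1..m}"] f_inv_into_f[of z e "{1..m}"]
    by (auto simp: idx_def bij_betw_def)
  \<comment> \<open>The difference of the forms for the two signs is the (k, k') entry of the
    symmetric part.\<close>
  define S :: "(nat \<Rightarrow> real) \<Rightarrow> real ^ 'k ^ 'k"
    where "S x = (\<chi> k k'. x (idx (k, k', True)) - x (idx (k, k', False)))" for x
  define \<Lambda> where "\<Lambda> j = t (e j)" for j
  have Q: "Q_fun 1 m \<Lambda> (\<lambda>x. \<psi> (S x)) X = \<psi> (sym_part X)" for X
  proof -
    have "entrywise_power X (Suc 0) = X" by (simp add: entrywise_power_def vec_eq_iff)
    moreover have "(X *v t (k, k', True)) \<bullet> t (k, k', True) - (X *v t (k, k', False)) \<bullet> t (k, k', False)
      = sym_part X $ k $ k'" for k k'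
      unfolding inner_commute[of "X *v _"]
      by (simp add: t_def sym_part_def transpose_def matrix_vector_mult_scaleR matrix_vector_right_distrib
          matrix_vector_mult_diff_distrib inner_add_left inner_add_right inner_diff_left inner_diff_right
          inner_axis_matrix field_simps)
    ultimately have "S (\<lambda>j\<in>{1..m}. (entrywise_power X 1 *v \<Lambda> j) \<bullet> \<Lambda> j) $ k $ k' = sym_part X $ k $ k'"
      for k k'
      using idx by (simp add: S_def \<Lambda>_def)
    then have "S (\<lambda>j\<in>{1..m}. (entrywise_power X 1 *v \<Lambda> j) \<bullet> \<Lambda> j) = sym_part X"
      by (simp add: vec_eq_iff)
    then show ?thesis by (simp add: Q_fun_def)
  qed
  have "continuous_on UNIV S"
    unfolding S_def by (intro continuous_intros continuous_on_product_coordinates)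
  then have "(\<lambda>x. \<psi> (S x)) \<in> borel_measurable borel"
    by (intro measurable_compose[OF _ \<psi>(1)] borel_measurable_continuous_onI)
  then have \<psi>S: "(\<lambda>x. \<psi> (S x)) \<in> borel_measurable (\<Pi>\<^sub>M j\<in>{1..m}. borel)"
    by (rule measurable_compose[OF measurable_PiM_ident])
  have m: "1 \<le> m" by (simp add: m_def Suc_le_eq)
  have \<Lambda>: "\<Lambda> j $ k \<in> {-1..1}" for j k
    by (cases "e j") (auto simp: \<Lambda>_def t_def axis_def)
  have fM: "f \<in> borel_measurable (\<Pi>\<^sub>M x\<in>block n. borel)"
    by (rule measurable_compose[OF measurable_PiM_ident f(1)])
  have \<psi>R: "(\<lambda>R :: 'k overlap_array. \<psi> (sym_part (R x))) \<in> borel_measurable borel" for x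
    using \<psi>(1) by (rule measurable_compose[rotated])
      (auto intro!: borel_measurable_continuous_onI continuous_intros)
  have "(\<integral>R. f (restrict R (block n)) * Q_fun 1 m \<Lambda> (\<lambda>x. \<psi> (S x)) (R (1, n + 1)) \<partial>\<mu>) =
          1 / real n * (\<integral>R. f (restrict R (block n)) \<partial>\<mu>) * (\<integral>R. Q_fun 1 m \<Lambda> (\<lambda>x. \<psi> (S x)) (R (1, 2)) \<partial>\<mu>) +
          1 / real n *
            (\<Sum>l\<in>{2..n}. \<integral>R. f (restrict R (block n)) * Q_fun 1 m \<Lambda> (\<lambda>x. \<psi> (S x)) (R (1, l)) \<partial>\<mu>)"
    by (rule GG_\<mu>[unfolded multi_species_GG_def, rule_format])
      (use n f(2) \<psi>(2) \<psi>S m \<Lambda> fM in blast)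
  then show ?thesis
    unfolding Q local_restrict[OF f(3)]
    using f(1) \<psi>R by (simp add: integral_law)
qed

text \<open>\<open>D\<close> is read off from an arbitrary array of the support; by
  \<open>law_support_diag_eq\<close> the choice does not matter.\<close>

sublocale GG_array law "(SOME A. A \<in> array_support law) (1, 1)" "real CARD('k) * real CARD('k)"
proof
  show "A (i, i) = (SOME A. A \<in> array_support law) (1, 1)" if "A \<in> array_support law" "1 \<le> i" for A i
    using law_support_diag_eq[OF that(1) someI_ex[of "\<lambda>A. A \<in> array_support law"]] that by auto
qed (fact law_exchangeable law_GG law_support_transpose law_support_gram law_support_bounded)+

end

theorem theorem3:
  "\<exists>L :: real. \<forall>(j0 :: real ^ 'k \<Rightarrow> nat) (a :: real) (u :: nat \<Rightarrow> 'k pert_index \<Rightarrow> real)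
      (d :: nat \<Rightarrow> real ^ 'k) (r :: nat \<Rightarrow> nat) (\<mu> :: (nat \<times> nat \<Rightarrow> real ^ 'k ^ 'k) measure).
    inj_on j0 rational_cube \<and>
    1 / 4 < a \<and> a < 1 / 2 \<and>
    (\<forall>N\<ge>1. \<forall>\<theta>\<in>pert_indices. u N \<theta> \<in> {1..2}) \<and>
    (\<forall>N\<ge>1. d N \<in> attainable_proportions N) \<and>
    strict_mono r \<and>
    limiting_overlap_law j0 a u d r \<mu> \<and>
    multi_species_GG \<mu> \<longrightarrow>
    (\<exists>\<Phi> :: real \<Rightarrow> real ^ 'k ^ 'k.
      (\<forall>x\<ge>0. \<Phi> x \<in> psd) \<and>
      (AE R in \<mu>. \<forall>l\<ge>1. \<forall>l'\<ge>1. 0 \<le> trace (R (l, l')) \<and> R (l, l') = \<Phi> (trace (R (l, l')))) \<and>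
      (\<forall>x x'. 0 \<le> x \<and> x \<le> x' \<longrightarrow> \<Phi> x' - \<Phi> x \<in> psd) \<and>
      (\<forall>x\<ge>0. \<forall>x'\<ge>0. norm1 (\<Phi> x' - \<Phi> x) \<le> L * \<bar>x' - x\<bar>))"
\<comment> \<open>The constant is \<kappa>, from the comparison of the entrywise norm with the
  trace.\<close>
proof (intro exI[of _ "real CARD('k)"] allI impI)
  fix j0 :: "real ^ 'k \<Rightarrow> nat" and a u d r and \<mu> :: "(nat \<times> nat \<Rightarrow> real ^ 'k ^ 'k) measure"
  assume asm: "inj_on j0 rational_cube \<and>
    1 / 4 < a \<and> a < 1 / 2 \<and>
    (\<forall>N\<ge>1. \<forall>\<theta>\<in>pert_indices. u N \<theta> \<in> {1..2}) \<and>
    (\<forall>N\<ge>1. d N \<in> attainable_proportions N) \<and>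
    strict_mono r \<and>
    limiting_overlap_law j0 a u d r \<mu> \<and>
    multi_species_GG \<mu>"
  interpret limiting_array j0 a u d r \<mu>
    by standard (use asm in auto)
  obtain \<Phi> where \<Phi>: "\<And>x. 0 \<le> x \<Longrightarrow> \<Phi> x \<in> psd"
    "AE R in law. \<forall>i\<ge>1. \<forall>j\<ge>1. 0 \<le> trace (R (i, j)) \<and> R (i, j) = \<Phi> (trace (R (i, j)))"
    "\<And>x x'. 0 \<le> x \<Longrightarrow> x \<le> x' \<Longrightarrow> \<Phi> x' - \<Phi> x \<in> psd"
    "\<And>x x'. 0 \<le> x \<Longrightarrow> 0 \<le> x' \<Longrightarrow> norm1 (\<Phi> x' - \<Phi> x) \<le> real CARD('k) * \<bar>x' - x\<bar>"
    by (rule synchronization, rule that)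
  have "AE R in \<mu>. \<forall>i\<ge>1. \<forall>j\<ge>1. 0 \<le> trace (R (i, j)) \<and> R (i, j) = \<Phi> (trace (R (i, j)))"
    using \<Phi>(2) AE_distrD[OF ident_measurable] unfolding law_def by blast
  then show "\<exists>\<Phi> :: real \<Rightarrow> real ^ 'k ^ 'k.
      (\<forall>x\<ge>0. \<Phi> x \<in> psd) \<and>
      (AE R in \<mu>. \<forall>l\<ge>1. \<forall>l'\<ge>1. 0 \<le> trace (R (l, l')) \<and> R (l, l') = \<Phi> (trace (R (l, l')))) \<and>
      (\<forall>x x'. 0 \<le> x \<and> x \<le> x' \<longrightarrow> \<Phi> x' - \<Phi> x \<in> psd) \<and>
      (\<forall>x\<ge>0. \<forall>x'\<ge>0. norm1 (\<Phi> x' - \<Phi> x) \<le> real CARD('k) * \<bar>x' - x\<bar>)"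
    using \<Phi>(1,3,4) by blast
qed

end
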